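(* Let $0<s<1$ and let $u\in L^\infty(\mathbb{R}^n)$ be real-valued. (i) If $n=1$ and $(-\Delta)^s u=u$ in $\mathbb{R}$, then there exist constants $A,B\in\mathbb{R}$ such that $u(x)=A\cos(x)+B\sin(x)$. (ii) If $n\ge 2$ and $u(x)\to 0$ as $|x|\to\infty$, then $(-\Delta)^s u=u$ in $\mathbb{R}^n$ if and only if $-\Delta u=u$ in $\mathbb{R}^n$.
   Context: The fractional Laplacian $(-\Delta)^s$ is the operator with Fourier multiplier $|\xi|^{2s}$, i.e. $\widehat{(-\Delta)^s u}(\xi)=|\xi|^{2s}\hat u(\xi)$, understood in the distributional sense: for $u\in L^\infty(\mathbb{R}^n)$, $(-\Delta)^s u$ is defined by $\langle (-\Delta)^s u,\phi\rangle=\int_{\mathbb{R}^n}u\,(-\Delta)^s\phi\,dx$ for Schwartz functions $\phi$. For sufficiently regular $u$ it coincides with the singular integral $c_{n,s}\,\mathrm{P.V.}\int_{\mathbb{R}^n}\frac{u(x)-u(y)}{|x-y|^{n+2s}}\,dy$, where $c_{n,s}>0$ is a normalization constant. The equation $-\Delta u=u$ is the classical Helmholtz equation (in the distributional sense). *)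

theory Defs
  imports "HOL-Analysis.Analysis"
begin

definition partial_deriv ::
    "'a::euclidean_space \<Rightarrow> ('a \<Rightarrow> 'b::real_normed_vector) \<Rightarrow> 'a \<Rightarrow> 'b"
  where "partial_deriv b f x = frechet_derivative f (at x) b"

text \<open>A multi-index derivative is a list of basis directions. Since every iterated partial
  derivative is required to be differentiable at every point, the functions below are
  \<open>C\<^sup>\<infinity>\<close>, and \<^const>\<open>frechet_derivative\<close> is always a genuine derivative.\<close>

definition schwartz :: "('a::euclidean_space \<Rightarrow> complex) set"
  where "schwartz = {f. \<forall>bs \<in> lists Basis.
           (\<forall>x. foldr partial_deriv bs f differentiable (at x)) \<and>
           (\<forall>k::nat. bounded (range (\<lambda>x. norm x ^ k *\<^sub>R foldr partial_deriv bs f x)))}"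

definition laplacian :: "('a::euclidean_space \<Rightarrow> complex) \<Rightarrow> 'a \<Rightarrow> complex"
  where "laplacian f x = (\<Sum>b\<in>Basis. partial_deriv b (partial_deriv b f) x)"

text \<open>The Fourier transform is normalised without a factor \<open>2\<pi>\<close> in the exponent, so that
  \<open>-\<Delta>\<close> has the symbol \<open>|\<xi>|\<^sup>2\<close>.\<close>

definition fourier :: "('a::euclidean_space \<Rightarrow> complex) \<Rightarrow> 'a \<Rightarrow> complex"
  where "fourier f \<xi> = (LINT x|lebesgue. exp (- (\<i> * complex_of_real (x \<bullet> \<xi>))) * f x)"

definition inverse_fourier :: "('a::euclidean_space \<Rightarrow> complex) \<Rightarrow> 'a \<Rightarrow> complex"
  where "inverse_fourier g x =
    complex_of_real (1 / (2 * pi) ^ DIM('a)) *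
      (LINT \<xi>|lebesgue. exp (\<i> * complex_of_real (x \<bullet> \<xi>)) * g \<xi>)"

definition frac_laplacian ::
    "real \<Rightarrow> ('a::euclidean_space \<Rightarrow> complex) \<Rightarrow> 'a \<Rightarrow> complex"
  where "frac_laplacian s f =
    inverse_fourier (\<lambda>\<xi>. complex_of_real (norm \<xi> powr (2 * s)) * fourier f \<xi>)"

definition L_infty :: "('a::euclidean_space \<Rightarrow> real) set"
  where "L_infty = {u \<in> borel_measurable lebesgue. \<exists>C. AE x in lebesgue. \<bar>u x\<bar> \<le> C}"

definition pairing :: "('a::euclidean_space \<Rightarrow> real) \<Rightarrow> ('a \<Rightarrow> complex) \<Rightarrow> complex"
  where "pairing u \<phi> = (LINT x|lebesgue. complex_of_real (u x) * \<phi> x)"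

text \<open>The operators applied to \<open>u\<close> in the sense of distributions, as functionals of the test
  function \<open>\<phi>\<close>. Both operators are symmetric, and for Schwartz \<open>\<phi>\<close> the function
  \<open>(-\<Delta>)\<^sup>s \<phi>\<close> is integrable, so the pairing with a bounded \<open>u\<close> is meaningful.\<close>

definition distributional_frac_laplacian ::
    "real \<Rightarrow> ('a::euclidean_space \<Rightarrow> real) \<Rightarrow> ('a \<Rightarrow> complex) \<Rightarrow> complex"
  where "distributional_frac_laplacian s u \<phi> = pairing u (frac_laplacian s \<phi>)"

definition distributional_laplacian ::
    "('a::euclidean_space \<Rightarrow> real) \<Rightarrow> ('a \<Rightarrow> complex) \<Rightarrow> complex"
  where "distributional_laplacian u \<phi> = pairing u (laplacian \<phi>)"

definition frac_helmholtz :: "real \<Rightarrow> ('a::euclidean_space \<Rightarrow> real) \<Rightarrow> bool"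
  where "frac_helmholtz s u \<longleftrightarrow>
    (\<forall>\<phi>\<in>schwartz. distributional_frac_laplacian s u \<phi> = pairing u \<phi>)"

definition helmholtz :: "('a::euclidean_space \<Rightarrow> real) \<Rightarrow> bool"
  where "helmholtz u \<longleftrightarrow> (\<forall>\<phi>\<in>schwartz. - distributional_laplacian u \<phi> = pairing u \<phi>)"

text \<open>The limit at infinity of an \<open>L\<^sup>\<infinity>\<close> function, insensitive to null sets:
  for every \<open>\<epsilon> > 0\<close> there is \<open>R\<close> such that \<open>|u x| < \<epsilon>\<close> for almost every \<open>x\<close> with \<open>|x| \<ge> R\<close>.
  Equivalently, some representative of \<open>u\<close> tends to \<open>0\<close> at infinity.\<close>

definition vanishes_at_infinity :: "('a::euclidean_space \<Rightarrow> real) \<Rightarrow> bool"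
  where "vanishes_at_infinity u \<longleftrightarrow> (u \<longlongrightarrow> 0) (inf at_infinity (ae_filter lebesgue))"

end

theory Submission
  imports Defs "HOL-Probability.Probability"
begin

text \<open>Write \<open>A = -\<Delta>\<close>. The fractional equation says that \<open>u\<close> annihilates \<open>(A\<^sup>s - 1) f\<close> for every
  Schwartz function \<open>f\<close>, the classical one that it annihilates \<open>(A - 1) f\<close>. The two families are
  linked by a scalar identity (\<open>stieltjes_representation\<close>): for \<open>r \<ge> 0\<close>,
  \<open>r\<^sup>s - 1 = (r - 1) \<integral> \<mu> / (\<mu> + r) d\<kappa>(\<mu>)\<close>, where \<open>\<kappa>\<close> is the probability measure on
  \<open>(0, \<infinity>)\<close> with density proportional to \<open>\<mu>\<^sup>s\<^sup>-\<^sup>1 / (\<mu> + 1)\<close>. The operator \<open>\<mu> / (\<mu> + A)\<close> is an average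
  over translations: it is convolution with the law of \<open>\<zeta> / \<surd>\<mu>\<close>, where \<open>\<zeta>\<close> is Brownian motion with
  generator \<open>\<Delta>\<close> at an independent exponential time. Hence (\<open>frac_laplacian_average\<close>) \<open>A\<^sup>s f - f\<close> is
  the average of the translates \<open>g(x - \<zeta> / \<surd>\<mu>)\<close> of \<open>g = (A - 1) f\<close>. In particular \<open>A\<^sup>s f\<close> is integrable, and with
  \<open>V(y) = \<langle>u, g(\<sqdot> - y)\<rangle>\<close> one gets \<open>\<langle>u, A\<^sup>s f\<rangle> - \<langle>u, f\<rangle> = E V(\<zeta> / \<surd>\<mu>)\<close>.

  If \<open>u\<close> solves the classical equation, then \<open>V = 0\<close> because translates of Schwartz functions are
  Schwartz functions, and the fractional equation follows.

  Conversely, let \<open>u\<close> solve the fractional equation and let \<open>Q\<^sub>\<mu> V(y) = E V(y + \<zeta> / \<surd>\<mu>)\<close> with \<open>\<mu>\<close>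
  fixed, a Markov operator. Testing with the translates of \<open>f\<close> gives \<open>\<integral> Q\<^sub>\<mu> V d\<kappa>(\<mu>) = 0\<close>. Testing with
  the translates of \<open>A f\<close> gives \<open>\<integral> \<mu> (V - Q\<^sub>\<mu> V) d\<kappa>(\<mu>) = 0\<close>, since \<open>A \<mu> / (\<mu> + A) = \<mu> (1 - \<mu> / (\<mu> + A))\<close>.
  A maximum principle (\<open>averaged_markov_nonpos\<close>) shows that these two properties force \<open>V = 0\<close>: both
  \<open>V\<close> and \<open>\<mu> (V - Q\<^sub>\<mu> V)\<close> are bounded, the latter being the average for the test function \<open>A f\<close>. So
  \<open>\<langle>u, (A - 1) f\<rangle> = V(0) = 0\<close>.

  On the line, every mollification \<open>w\<close> of a solution of the classical equation satisfies
  \<open>w'' = -w\<close>, so it is a combination of \<open>cos\<close> and \<open>sin\<close>. The coefficients converge as the mollifier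
  shrinks, because they can be read off from the integrals of \<open>w\<close> over \<open>[0, \<pi>]\<close> and \<open>[0, \<pi>/2]\<close>,
  which converge to those of the solution (\<open>helmholtz_1D\<close>).\<close>

section \<open>Integrals over Euclidean space\<close>

lemma integrable_mult_bounded:
  fixes f g :: "'a \<Rightarrow> complex"
  assumes "integrable M f" and [measurable]: "g \<in> borel_measurable M" and "\<And>x. norm (g x) \<le> B"
  shows "integrable M (\<lambda>x. g x * f x)"
proof (rule Bochner_Integration.integrable_bound)
  show "integrable M (\<lambda>x. of_real B * f x)" using assms(1) by simp
  show "(\<lambda>x. g x * f x) \<in> borel_measurable M" using assms(1) by measurable
  show "AE x in M. norm (g x * f x) \<le> norm (of_real B * f x)"
    using assms(3) by (auto simp: norm_mult intro!: mult_right_mono order_trans[OF _ abs_ge_self])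
qed

text \<open>The form in which Fubini's theorem is applied below: an integrable function of one variable times a
  bounded kernel, typically an oscillating exponential.\<close>

lemma integrable_pair_mult_bounded:
  fixes g :: "'a \<Rightarrow> complex" and k :: "'a \<times> 'b \<Rightarrow> complex"
  assumes M: "sigma_finite_measure M" and P: "prob_space P"
    and g: "integrable M g" and k[measurable]: "k \<in> borel_measurable (M \<Otimes>\<^sub>M P)"
    and B: "\<And>z. norm (k z) \<le> B"
  shows "integrable (M \<Otimes>\<^sub>M P) (\<lambda>(x, w). k (x, w) * g x)"
proof -
  interpret P: prob_space P by fact
  interpret M: sigma_finite_measure M by fact
  interpret Q: pair_sigma_finite M P ..
  have [measurable]: "g \<in> borel_measurable M" using g by auto
  have "integrable (M \<Otimes>\<^sub>M P) (\<lambda>z. g (fst z))"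
    by (rule Q.Fubini_integrable) (use g in \<open>auto simp: P.prob_space\<close>)
  from integrable_mult_bounded[OF this k B] show ?thesis by (simp add: case_prod_beta')
qed

lemma lborel_integral_prod:
  fixes f :: "'a::euclidean_space \<Rightarrow> real \<Rightarrow> complex"
  assumes "\<And>b. b \<in> Basis \<Longrightarrow> integrable lborel (f b)"
  shows "integrable lborel (\<lambda>x. \<Prod>b\<in>Basis. f b (x \<bullet> b))"
    and "(LINT x|lborel. (\<Prod>b\<in>Basis. f b (x \<bullet> b))) = (\<Prod>b\<in>Basis. LINT t|lborel. f b t)"
proof -
  interpret product_sigma_finite "\<lambda>_::'a. lborel :: real measure" ..
  have [measurable]: "f b \<in> borel_measurable borel" if "b \<in> Basis" for b
    using assms[OF that] by auto
  have *: "(\<Sum>c\<in>Basis. g c *\<^sub>R c) \<bullet> b = g b" if "b \<in> Basis" for g and b :: 'a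
    using that by (simp add: inner_sum_left inner_Basis if_distrib cong: if_cong)
  have m: "(\<lambda>x::'a. \<Prod>b\<in>Basis. f b (x \<bullet> b)) \<in> borel_measurable borel" by measurable
  show "integrable lborel (\<lambda>x. \<Prod>b\<in>Basis. f b (x \<bullet> b))"
    by (subst lborel_eq) (use product_integrable_prod[of Basis f] assms m in
      \<open>simp add: integrable_distr_eq * cong: prod.cong\<close>)
  show "(LINT x|lborel. (\<Prod>b\<in>Basis. f b (x \<bullet> b))) = (\<Prod>b\<in>Basis. LINT t|lborel. f b t)"
    by (subst lborel_eq) (use product_integral_prod[of Basis f] assms m in
      \<open>simp add: integral_distr * cong: prod.cong\<close>)
qed

lemma lborel_integral_affine:
  fixes f :: "'a::euclidean_space \<Rightarrow> complex"
  assumes c: "c \<noteq> 0" and f[measurable]: "f \<in> borel_measurable borel"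
  shows "integrable lborel (\<lambda>x. f (t + c *\<^sub>R x)) \<longleftrightarrow> integrable lborel f"
    and "(LINT x|lborel. f x) = \<bar>c\<bar> ^ DIM('a) *\<^sub>R (LINT x|lborel. f (t + c *\<^sub>R x))"
proof -
  have "integrable lborel f \<longleftrightarrow> integrable lborel (\<lambda>x. (\<bar>c\<bar> ^ DIM('a)) *\<^sub>R f (t + c *\<^sub>R x))"
    by (subst lborel_affine[OF c, of t])
       (simp add: integrable_density integrable_distr_eq)
  then show "integrable lborel (\<lambda>x. f (t + c *\<^sub>R x)) \<longleftrightarrow> integrable lborel f"
    using c integrable_scaleR_right[of "inverse (\<bar>c\<bar> ^ DIM('a))" lborel "\<lambda>x. (\<bar>c\<bar> ^ DIM('a)) *\<^sub>R f (t + c *\<^sub>R x)"]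
    by auto
  show "(LINT x|lborel. f x) = \<bar>c\<bar> ^ DIM('a) *\<^sub>R (LINT x|lborel. f (t + c *\<^sub>R x))"
    by (subst lborel_affine[OF c, of t])
       (simp add: integral_density integral_distr)
qed

lemma lborel_integral_translate:
  fixes f :: "'a::euclidean_space \<Rightarrow> complex"
  assumes "f \<in> borel_measurable borel"
  shows "integrable lborel (\<lambda>x. f (x + y)) \<longleftrightarrow> integrable lborel f"
    and "(LINT x|lborel. f (x + y)) = (LINT x|lborel. f x)"
  using lborel_integral_affine[of 1 f y] assms by (simp_all add: add.commute)

definition std_gauss :: "'a::euclidean_space \<Rightarrow> real"
  where "std_gauss x = (\<Prod>b\<in>Basis. std_normal_density (x \<bullet> b))"

lemma std_gauss_measurable [measurable]: "std_gauss \<in> borel_measurable borel"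
  unfolding std_gauss_def by measurable

lemma std_gauss_pos: "std_gauss x > 0"
  unfolding std_gauss_def by (intro prod_pos) (auto simp: normal_density_pos)

lemma sum_inner_squares: "(\<Sum>b\<in>Basis. (x \<bullet> b)\<^sup>2) = (norm (x::'a::euclidean_space))\<^sup>2"
  by (subst euclidean_inner[of x x, folded power2_norm_eq_inner, simplified power2_norm_eq_inner[symmetric]])
     (simp add: power2_eq_square)

lemma std_gauss_eq: "std_gauss (x::'a::euclidean_space) = exp (- (norm x)\<^sup>2 / 2) / sqrt (2 * pi) ^ DIM('a)"
proof -
  have "std_gauss x = (\<Prod>b\<in>(Basis::'a set). exp (- (x \<bullet> b)\<^sup>2 / 2)) * (\<Prod>b\<in>(Basis::'a set). 1 / sqrt (2 * pi))"
    unfolding std_gauss_def std_normal_density_def by (subst prod.distrib[symmetric]) (simp add: mult.commute)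
  also have "(\<Prod>b\<in>(Basis::'a set). exp (- (x \<bullet> b)\<^sup>2 / 2)) = exp (- (norm x)\<^sup>2 / 2)"
    by (subst exp_sum[symmetric]) (auto simp: sum_negf sum_divide_distrib[symmetric] sum_inner_squares)
  finally show ?thesis by (simp add: power_divide)
qed

lemma gauss_fourier_1D:
  "integrable lborel (\<lambda>t. exp (\<i> * of_real (t * r)) * of_real (std_normal_density t))"
  "(LINT t|lborel. exp (\<i> * of_real (t * r)) * of_real (std_normal_density t)) = of_real (exp (- r\<^sup>2 / 2))"
proof -
  show "integrable lborel (\<lambda>t. exp (\<i> * of_real (t * r)) * of_real (std_normal_density t))"
    by (rule integrable_mult_bounded[of _ _ _ 1]) (auto simp: norm_exp_i_times intro: integrable_of_real)
  have "char std_normal_distribution r = of_real (exp (- r\<^sup>2 / 2))"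
    by (simp add: char_std_normal_distribution)
  then show "(LINT t|lborel. exp (\<i> * of_real (t * r)) * of_real (std_normal_density t)) = of_real (exp (- r\<^sup>2 / 2))"
    unfolding char_def
    by (subst (asm) integral_density) (auto simp: normal_density_nonneg scaleR_conv_of_real mult_ac)
qed

lemma gauss_fourier:
  fixes \<xi> :: "'a::euclidean_space"
  shows "integrable lborel (\<lambda>x. exp (\<i> * of_real (x \<bullet> \<xi>)) * of_real (std_gauss x))"
    and "(LINT x|lborel. exp (\<i> * of_real (x \<bullet> \<xi>)) * of_real (std_gauss x)) = of_real (exp (- (norm \<xi>)\<^sup>2 / 2))"
proof -
  define f where "f b t = exp (\<i> * of_real (t * (\<xi> \<bullet> b))) * of_real (std_normal_density t)" for b t
  have eq: "exp (\<i> * of_real (x \<bullet> \<xi>)) * of_real (std_gauss x) = (\<Prod>b\<in>Basis. f b (x \<bullet> b))" for x :: 'a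
  proof -
    have "exp (\<i> * of_real (x \<bullet> \<xi>)) = (\<Prod>b\<in>Basis. exp (\<i> * of_real ((x \<bullet> b) * (\<xi> \<bullet> b))))"
      by (subst euclidean_inner) (simp add: sum_distrib_left exp_sum)
    then show ?thesis by (simp add: f_def std_gauss_def prod.distrib)
  qed
  note P = lborel_integral_prod[of f, folded eq]
  show "integrable lborel (\<lambda>x. exp (\<i> * of_real (x \<bullet> \<xi>)) * of_real (std_gauss x))"
    by (rule P(1)) (unfold f_def, rule gauss_fourier_1D)
  have "(LINT x|lborel. exp (\<i> * of_real (x \<bullet> \<xi>)) * of_real (std_gauss x)) =
      (\<Prod>b\<in>Basis. LINT t|lborel. f b t)"
    by (rule P(2)) (unfold f_def, rule gauss_fourier_1D)
  also have "\<dots> = (\<Prod>b\<in>Basis. of_real (exp (- (\<xi> \<bullet> b)\<^sup>2 / 2)))"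
    by (simp only: f_def gauss_fourier_1D)
  also have "\<dots> = complex_of_real (exp (- (norm \<xi>)\<^sup>2 / 2))"
    by (subst of_real_prod[symmetric], subst exp_sum[symmetric])
       (auto simp: sum_negf sum_divide_distrib[symmetric] sum_inner_squares)
  finally show "(LINT x|lborel. exp (\<i> * of_real (x \<bullet> \<xi>)) * of_real (std_gauss x)) = of_real (exp (- (norm \<xi>)\<^sup>2 / 2))" .
qed

lemma std_gauss_integral:
  "integrable lborel (std_gauss :: 'a::euclidean_space \<Rightarrow> real)"
  "(LINT x|lborel. std_gauss (x::'a)) = 1"
proof -
  have *: "integrable lborel (\<lambda>x::'a. complex_of_real (std_gauss x))"
      "(LINT x|lborel. complex_of_real (std_gauss (x::'a))) = 1"
    using gauss_fourier[of "0::'a"] by simp_all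
  from integrable_Re[OF *(1)] show "integrable lborel (std_gauss :: 'a \<Rightarrow> real)" by simp
  from *(2) show "(LINT x|lborel. std_gauss (x::'a)) = 1" by simp
qed

definition gauss_measure :: "'a::euclidean_space measure"
  where "gauss_measure = density lborel (\<lambda>x. ennreal (std_gauss x))"

lemma sets_gauss_measure [simp, measurable_cong]: "sets gauss_measure = sets borel"
  by (simp add: gauss_measure_def)

lemma space_gauss_measure [simp]: "space gauss_measure = UNIV"
  by (simp add: gauss_measure_def)

lemma prob_space_gauss: "prob_space (gauss_measure :: 'a::euclidean_space measure)"
proof
  have "emeasure (gauss_measure :: 'a measure) (space gauss_measure) = (\<integral>\<^sup>+x. ennreal (std_gauss (x::'a)) \<partial>lborel)"
    by (simp add: gauss_measure_def emeasure_density)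
  also have "\<dots> = 1"
    using std_gauss_integral[where 'a='a] by (subst nn_integral_eq_integral) (auto intro: less_imp_le std_gauss_pos)
  finally show "emeasure (gauss_measure :: 'a measure) (space gauss_measure) = 1" .
qed

lemma gauss_measure_integral:
  fixes f :: "'a::euclidean_space \<Rightarrow> complex"
  assumes [measurable]: "f \<in> borel_measurable borel"
  shows "(LINT x|gauss_measure. f x) = (LINT x|lborel. of_real (std_gauss x) * f x)"
  unfolding gauss_measure_def
  by (subst integral_density) (auto intro: less_imp_le std_gauss_pos simp: scaleR_conv_of_real)

lemma gauss_measure_charfun:
  "(LINT z|gauss_measure. exp (\<i> * of_real (z \<bullet> \<xi>))) = of_real (exp (- (norm (\<xi>::'a::euclidean_space))\<^sup>2 / 2))"
proof -
  have "(LINT z|gauss_measure. exp (\<i> * of_real (z \<bullet> \<xi>))) = 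
      (LINT z|lborel. of_real (std_gauss z) * exp (\<i> * of_real (z \<bullet> \<xi>)))"
    by (rule gauss_measure_integral) measurable
  also have "\<dots> = of_real (exp (- (norm \<xi>)\<^sup>2 / 2))"
    by (subst mult.commute) (rule gauss_fourier(2))
  finally show ?thesis .
qed

text \<open>If \<open>\<tau>\<close> is exponentially distributed and \<open>Z\<close> is an independent standard Gaussian vector, then
  \<open>\<surd>(2\<tau>) Z\<close> is Brownian motion stopped at an exponential time; its law is the kernel of the
  resolvent \<open>(1 - \<Delta>)\<inverse>\<close>.\<close>

definition resolvent_measure :: "'a::euclidean_space measure"
  where "resolvent_measure =
    distr (density lborel (exponential_density 1) \<Otimes>\<^sub>M gauss_measure) borel (\<lambda>(t, z). sqrt (2 * t) *\<^sub>R z)"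

lemma sets_resolvent_measure [simp, measurable_cong]: "sets resolvent_measure = sets borel"
  by (simp add: resolvent_measure_def)

lemma space_resolvent_measure [simp]: "space resolvent_measure = UNIV"
  by (simp add: resolvent_measure_def)

lemma prob_space_resolvent: "prob_space (resolvent_measure :: 'a::euclidean_space measure)"
proof -
  interpret E: prob_space "density lborel (exponential_density 1)"
    by (rule prob_space_exponential_density) simp
  interpret G: prob_space "gauss_measure :: 'a measure" by (rule prob_space_gauss)
  interpret pair_prob_space "density lborel (exponential_density 1)" "gauss_measure :: 'a measure" ..
  show ?thesis unfolding resolvent_measure_def by (rule prob_space_distr) measurable
qed

text \<open>Tilting the exponential density by \<open>e\<^sup>-\<^sup>a\<^sup>t\<close> gives \<open>1 / (1 + a)\<close> times the exponential density with
  rate \<open>1 + a\<close>.\<close>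

lemma exp_laplace:
  assumes "0 \<le> (a::real)"
  shows "(LINT t|density lborel (exponential_density 1). exp (- a * t)) = 1 / (1 + a)"
proof -
  interpret D: prob_space "density lborel (exponential_density (1 + a))"
    by (rule prob_space_exponential_density) (use assms in simp)
  have "(LINT t|density lborel (exponential_density 1). exp (- a * t))
      = (LINT t|lborel. exponential_density 1 t * exp (- a * t))"
    by (subst integral_density) (auto simp: exponential_density_nonneg)
  also have "\<dots> = (LINT t|lborel. (1 / (1 + a)) * exponential_density (1 + a) t)"
    using assms by (intro Bochner_Integration.integral_cong)
      (auto simp: exponential_density_def mult_exp_exp field_simps add_pos_nonneg)
  also have "\<dots> = (1 / (1 + a)) * (LINT t|density lborel (exponential_density (1 + a)). 1)"
    using assms by (subst integral_density) (auto simp: exponential_density_nonneg)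
  also have "\<dots> = 1 / (1 + a)" using D.prob_space by simp
  finally show ?thesis .
qed

text \<open>Conditionally on the time \<open>t\<close>, the vector \<open>\<surd>(2t) Z\<close> has characteristic function
  \<open>exp (-t |\<xi>|\<^sup>2)\<close>; averaging over \<open>t\<close> leaves a Laplace transform.\<close>

lemma resolvent_measure_charfun:
  fixes \<xi> :: "'a::euclidean_space"
  shows "(LINT z|resolvent_measure. exp (- (\<i> * of_real (z \<bullet> \<xi>)))) = of_real (1 / (1 + (norm \<xi>)\<^sup>2))"
proof -
  interpret E: prob_space "density lborel (exponential_density 1)"
    by (rule prob_space_exponential_density) simp
  interpret G: prob_space "gauss_measure :: 'a measure" by (rule prob_space_gauss)
  interpret EG: pair_prob_space "density lborel (exponential_density 1)" "gauss_measure :: 'a measure" ..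
  let ?E = "density lborel (exponential_density 1)" and ?G = "gauss_measure :: 'a measure"
  have "(LINT z|resolvent_measure. exp (- (\<i> * of_real (z \<bullet> \<xi>)))) =
      (LINT p|(?E \<Otimes>\<^sub>M ?G). exp (- (\<i> * of_real ((sqrt (2 * fst p) *\<^sub>R snd p) \<bullet> \<xi>))))"
    unfolding resolvent_measure_def by (subst integral_distr) (auto simp: case_prod_beta')
  also have "\<dots> = (LINT t|?E. LINT z|?G. exp (- (\<i> * of_real ((sqrt (2 * t) *\<^sub>R z) \<bullet> \<xi>))))"
    by (subst EG.integral_fst'[symmetric])
       (auto intro!: EG.P.integrable_const_bound[of _ 1] simp: norm_exp_i_times norm_exp_eq_Re)
  also have "\<dots> = (LINT t|?E. of_real (exp (- (norm \<xi>)\<^sup>2 * t)))"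
  proof (rule integral_cong_AE)
    show "AE t in ?E. (LINT z|?G. exp (- (\<i> * of_real ((sqrt (2 * t) *\<^sub>R z) \<bullet> \<xi>)))) =
        of_real (exp (- (norm \<xi>)\<^sup>2 * t))"
    proof (subst AE_density; (rule AE_I2)?)
      fix t show "0 < ennreal (exponential_density 1 t) \<longrightarrow> (LINT z|?G. exp (- (\<i> * of_real ((sqrt (2 * t) *\<^sub>R z) \<bullet> \<xi>)))) =
        of_real (exp (- (norm \<xi>)\<^sup>2 * t))"
      proof
        assume "0 < ennreal (exponential_density 1 t)"
        then have "t \<ge> 0" by (auto simp: exponential_density_def split: if_splits)
        have "(LINT z|?G. exp (- (\<i> * of_real ((sqrt (2 * t) *\<^sub>R z) \<bullet> \<xi>)))) =
          (LINT z|?G. exp (\<i> * of_real (z \<bullet> (- sqrt (2 * t) *\<^sub>R \<xi>))))" by simp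
        also have "\<dots> = of_real (exp (- (norm (- sqrt (2 * t) *\<^sub>R \<xi>))\<^sup>2 / 2))"
          by (rule gauss_measure_charfun)
        finally show "(LINT z|?G. exp (- (\<i> * of_real ((sqrt (2 * t) *\<^sub>R z) \<bullet> \<xi>)))) =
          of_real (exp (- (norm \<xi>)\<^sup>2 * t))" using \<open>t \<ge> 0\<close> by (simp add: power_mult_distrib mult.commute)
      qed
    qed simp
  qed auto
  also have "\<dots> = of_real (1 / (1 + (norm \<xi>)\<^sup>2))"
    by (subst integral_complex_of_real) (simp only: exp_laplace zero_le_power2)
  finally show ?thesis .
qed

section \<open>Schwartz functions\<close>

lemma schwartz_has_derivative:
  assumes "f \<in> schwartz"
  shows "(f has_derivative frechet_derivative f (at x)) (at x)"
proof -
  have "f differentiable (at x)"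
    using assms unfolding schwartz_def by (auto dest!: bspec[of _ _ "[]"])
  then show ?thesis by (simp add: frechet_derivative_works)
qed

text \<open>The Schwartz functions form the largest class of differentiable, rapidly decreasing functions that is
  closed under partial derivatives. To prove a closure property it is enough to exhibit such a class,
  without mentioning iterated derivatives.\<close>

lemma schwartz_coinduct:
  assumes diff: "\<And>f x. f \<in> S \<Longrightarrow> f differentiable (at x)"
    and bdd: "\<And>f k. f \<in> S \<Longrightarrow> \<exists>B. \<forall>x. norm x ^ k * norm (f x) \<le> B"
    and step: "\<And>f b. f \<in> S \<Longrightarrow> b \<in> Basis \<Longrightarrow> partial_deriv b f \<in> S"
  shows "S \<subseteq> schwartz"
proof
  fix f assume f: "f \<in> S"
  have S: "foldr partial_deriv bs f \<in> S" if "bs \<in> lists Basis" for bs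
    using that by induct (auto intro: f step)
  have "bounded (range (\<lambda>x. norm x ^ k *\<^sub>R g x))" if "g \<in> S" for g k
    using bdd[OF that, of k] unfolding bounded_iff by auto
  then show "f \<in> schwartz" unfolding schwartz_def using S diff by auto
qed

lemma schwartz_partial_deriv:
  assumes "f \<in> schwartz" "b \<in> Basis"
  shows "partial_deriv b f \<in> schwartz"
  unfolding schwartz_def
proof (clarsimp, intro conjI allI)
  fix bs assume "\<forall>x\<in>set bs. x \<in> (Basis :: 'a set)"
  then have *: "bs @ [b] \<in> lists Basis" using assms(2) by auto
  show "foldr partial_deriv bs (partial_deriv b f) differentiable at x" for x
    using assms(1) * unfolding schwartz_def by (auto dest!: bspec[of _ _ "bs @ [b]"])
  show "bounded (range (\<lambda>x. norm x ^ k *\<^sub>R foldr partial_deriv bs (partial_deriv b f) x))" for k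
    using assms(1) * unfolding schwartz_def by (auto dest!: bspec[of _ _ "bs @ [b]"])
qed

lemma schwartz_bound:
  assumes "f \<in> schwartz"
  shows "\<exists>B. \<forall>x. norm x ^ k * norm (f x) \<le> B"
proof -
  have "bounded (range (\<lambda>x. norm x ^ k *\<^sub>R f x))"
    using assms unfolding schwartz_def by (auto dest!: bspec[of _ _ "[]"])
  then show ?thesis unfolding bounded_iff by auto
qed

lemma one_plus_power_le: "(1 + r) ^ k \<le> 2 ^ k * (1 + r ^ k)" if "r \<ge> (0::real)"
proof (cases "r \<le> 1")
  case True
  then have "(1 + r) ^ k \<le> 2 ^ k" using that by (intro power_mono) auto
  also have "\<dots> \<le> 2 ^ k * (1 + r ^ k)" using that by simp
  finally show ?thesis .
next
  case False
  then have "(1 + r) ^ k \<le> (2 * r) ^ k" using that by (intro power_mono) auto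
  then show ?thesis by (simp add: power_mult_distrib algebra_simps add_increasing)
qed

lemma schwartz_decay:
  assumes "f \<in> schwartz"
  shows "\<exists>B\<ge>0. \<forall>x. (1 + (norm x)\<^sup>2) ^ k * norm (f x) \<le> B"
proof -
  obtain B0 where B0: "\<And>x. norm x ^ 0 * norm (f x) \<le> B0" using schwartz_bound[OF assms, of 0] by blast
  obtain B1 where B1: "\<And>x. norm x ^ (2 * k) * norm (f x) \<le> B1" using schwartz_bound[OF assms, of "2 * k"] by blast
  have "(1 + (norm x)\<^sup>2) ^ k * norm (f x) \<le> 2 ^ k * (B0 + B1)" for x
  proof -
    have "(1 + (norm x)\<^sup>2) ^ k * norm (f x) \<le> 2 ^ k * (1 + ((norm x)\<^sup>2) ^ k) * norm (f x)"
      by (intro mult_right_mono one_plus_power_le) auto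
    also have "\<dots> = 2 ^ k * (norm (f x) + norm x ^ (2 * k) * norm (f x))"
      by (simp add: algebra_simps flip: power_mult)
    also have "\<dots> \<le> 2 ^ k * (B0 + B1)" using B0[of x] B1[of x] by (intro mult_left_mono add_mono) auto
    finally show ?thesis .
  qed
  moreover from this have "2 ^ k * (B0 + B1) \<ge> 0" by (rule order_trans[rotated]) simp
  ultimately show ?thesis by blast
qed

lemma schwartz_bounded: "f \<in> schwartz \<Longrightarrow> \<exists>B\<ge>0. \<forall>x. norm (f x) \<le> B"
  using schwartz_decay[of f 0] by simp

lemma partial_deriv_add:
  assumes "f differentiable (at x)" "g differentiable (at x)"
  shows "partial_deriv b (\<lambda>x. f x + g x) x = partial_deriv b f x + partial_deriv b g x"
proof -
  have "((\<lambda>x. f x + g x) has_derivative (\<lambda>h. frechet_derivative f (at x) h + frechet_derivative g (at x) h)) (at x)"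
    using assms by (intro has_derivative_add) (auto simp: frechet_derivative_works)
  from frechet_derivative_at[OF this] show ?thesis by (simp add: partial_deriv_def fun_eq_iff)
qed

lemma schwartz_differentiable: "f \<in> schwartz \<Longrightarrow> f differentiable (at x)"
  using schwartz_has_derivative by (auto simp: differentiable_def)

lemma schwartz_add:
  assumes "f \<in> schwartz" "g \<in> schwartz"
  shows "(\<lambda>x. f x + g x) \<in> schwartz"
proof -
  have "{\<lambda>x. f x + g x |f g. f \<in> schwartz \<and> g \<in> schwartz} \<subseteq> (schwartz :: ('a \<Rightarrow> complex) set)"
  proof (rule schwartz_coinduct; clarify)
    fix f g :: "'a \<Rightarrow> complex" and x k b assume fg: "f \<in> schwartz" "g \<in> schwartz"
    then show "(\<lambda>x. f x + g x) differentiable (at x)"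
      by (intro differentiable_add schwartz_differentiable)
    obtain B C where BC: "\<And>x. norm x ^ k * norm (f x) \<le> B" "\<And>x. norm x ^ k * norm (g x) \<le> C"
      using schwartz_bound fg by metis
    have "norm x ^ k * norm (f x + g x) \<le> B + C" for x
      using mult_left_mono[OF norm_triangle_ineq[of "f x" "g x"], of "norm x ^ k"] BC[of x]
      by (simp add: algebra_simps)
    then show "\<exists>B. \<forall>x. norm x ^ k * norm (f x + g x) \<le> B" by blast
    assume b: "b \<in> (Basis :: 'a set)"
    show "\<exists>fa ga. partial_deriv b (\<lambda>x. f x + g x) = (\<lambda>x. fa x + ga x) \<and> fa \<in> schwartz \<and> ga \<in> schwartz"
      by (rule exI[of _ "partial_deriv b f"], rule exI[of _ "partial_deriv b g"])
         (use fg b in \<open>auto simp: fun_eq_iff intro!: partial_deriv_add schwartz_differentiable schwartz_partial_deriv\<close>)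
  qed
  then show ?thesis using assms by blast
qed

lemma schwartz_cmult:
  assumes "f \<in> schwartz"
  shows "(\<lambda>x. c * f x) \<in> schwartz"
proof -
  have "{\<lambda>x. c * f x |f. f \<in> schwartz} \<subseteq> (schwartz :: ('a \<Rightarrow> complex) set)"
  proof (rule schwartz_coinduct; clarify)
    fix f :: "'a \<Rightarrow> complex" and x k b assume f: "f \<in> schwartz"
    then show "(\<lambda>x. c * f x) differentiable (at x)"
      by (intro differentiable_mult differentiable_const schwartz_differentiable)
    obtain B where B: "\<And>x. norm x ^ k * norm (f x) \<le> B" using schwartz_bound f by metis
    have "norm x ^ k * norm (c * f x) \<le> norm c * B" for x
      using mult_left_mono[OF B[of x], of "norm c"] by (simp add: norm_mult algebra_simps)
    then show "\<exists>B. \<forall>x. norm x ^ k * norm (c * f x) \<le> B" by blast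
    assume b: "b \<in> (Basis :: 'a set)"
    have "partial_deriv b (\<lambda>x. c * f x) x = c * partial_deriv b f x" for x
    proof -
      have "((\<lambda>x. c * f x) has_derivative (\<lambda>h. c * frechet_derivative f (at x) h)) (at x)"
        by (intro has_derivative_mult_right schwartz_has_derivative f)
      from frechet_derivative_at[OF this] show ?thesis by (simp add: partial_deriv_def fun_eq_iff)
    qed
    then show "\<exists>fa. partial_deriv b (\<lambda>x. c * f x) = (\<lambda>x. c * fa x) \<and> fa \<in> schwartz"
      using schwartz_partial_deriv[OF f b] by auto
  qed
  then show ?thesis using assms by blast
qed

lemma schwartz_zero: "(\<lambda>x::'a::euclidean_space. 0) \<in> schwartz"
proof -
  have "{\<lambda>x::'a. 0} \<subseteq> schwartz"
  proof (rule schwartz_coinduct)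
    fix f :: "'a \<Rightarrow> complex" and b assume "f \<in> {\<lambda>x. 0}"
    then have f: "f = (\<lambda>x. 0)" by simp
    show "f differentiable (at x)" for x by (simp add: f)
    show "\<exists>B. \<forall>x. norm x ^ k * norm (f x) \<le> B" for k by (auto simp: f)
    show "partial_deriv b f \<in> {\<lambda>x. 0}" by (simp add: f partial_deriv_def fun_eq_iff)
  qed
  then show ?thesis by simp
qed

lemma schwartz_sum:
  assumes "\<And>i. i \<in> I \<Longrightarrow> f i \<in> schwartz"
  shows "(\<lambda>x::'a::euclidean_space. \<Sum>i\<in>I. f i x) \<in> schwartz"
  using assms
  by (induct I rule: infinite_finite_induct) (auto simp: schwartz_zero intro!: schwartz_add)

lemma schwartz_laplacian: "f \<in> schwartz \<Longrightarrow> laplacian f \<in> schwartz"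
  unfolding laplacian_def[abs_def] by (intro schwartz_sum schwartz_partial_deriv)

text \<open>The two functions have the same candidate derivatives, so \<^const>\<open>frechet_derivative\<close> chooses the same
  one for both, even where no derivative exists.\<close>

lemma partial_deriv_shift: "partial_deriv b (\<lambda>x. f (x + y)) x = partial_deriv b f (x + y)"
proof -
  have "((\<lambda>x. f (x + y)) has_derivative D) (at x) \<longleftrightarrow> (f has_derivative D) (at (x + y))" for D
  proof
    assume "((\<lambda>x. f (x + y)) has_derivative D) (at x)"
    then have "((\<lambda>x. f (x + y)) has_derivative D) (at ((x + y) - y))" by simp
    moreover have "((\<lambda>x. x - y) has_derivative (\<lambda>h. h)) (at (x + y))"
      by (auto intro!: derivative_eq_intros)
    ultimately show "(f has_derivative D) (at (x + y))"
      using has_derivative_compose[of "\<lambda>x. x - y" "\<lambda>h. h" "x + y" UNIV "\<lambda>x. f (x + y)" D] by simp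
  next
    assume "(f has_derivative D) (at (x + y))"
    moreover have "((\<lambda>x. x + y) has_derivative (\<lambda>h. h)) (at x)"
      by (auto intro!: derivative_eq_intros)
    ultimately show "((\<lambda>x. f (x + y)) has_derivative D) (at x)"
      using has_derivative_compose[of "\<lambda>x. x + y" "\<lambda>h. h" x UNIV f D] by simp
  qed
  then show ?thesis by (simp add: partial_deriv_def frechet_derivative_def)
qed

lemma one_plus_norm_sq_shift:
  "1 + (norm x)\<^sup>2 \<le> 2 * (1 + (norm y)\<^sup>2) * (1 + (norm (x + y))\<^sup>2)"
proof -
  have "norm x \<le> norm (x + y) + norm y" by (metis add_diff_cancel norm_triangle_ineq4)
  then have "(norm x)\<^sup>2 \<le> (norm (x + y) + norm y)\<^sup>2" by (intro power_mono) auto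
  also have "\<dots> \<le> 2 * (norm (x + y))\<^sup>2 + 2 * (norm y)\<^sup>2"
    using sum_squares_bound[of "norm (x + y)" "norm y"] by (simp add: power2_sum)
  finally have "1 + (norm x)\<^sup>2 \<le> 2 * (norm (x + y))\<^sup>2 + 2 * (norm y)\<^sup>2 + 2" by simp
  also have "\<dots> \<le> 2 * (1 + (norm y)\<^sup>2) * (1 + (norm (x + y))\<^sup>2)" by (simp add: algebra_simps)
  finally show ?thesis .
qed

lemma schwartz_shift:
  assumes "f \<in> schwartz"
  shows "(\<lambda>x. f (x + y)) \<in> schwartz"
proof -
  have "{\<lambda>x. f (x + y) |f. f \<in> schwartz} \<subseteq> (schwartz :: ('a \<Rightarrow> complex) set)"
  proof (rule schwartz_coinduct; clarify)
    fix f :: "'a \<Rightarrow> complex" and x k b assume f: "f \<in> schwartz"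
    show "(\<lambda>x. f (x + y)) differentiable (at x)"
      using differentiable_compose[of f "\<lambda>x. x + y" x UNIV] schwartz_differentiable[OF f] by auto
    obtain B where B: "\<And>x. (1 + (norm x)\<^sup>2) ^ k * norm (f x) \<le> B" using schwartz_decay f by metis
    have "norm x ^ k * norm (f (x + y)) \<le> (2 * (1 + (norm y)\<^sup>2)) ^ k * B" for x
    proof -
      have "norm x \<le> 1 + (norm x)\<^sup>2" using sum_squares_bound[of "norm x" 1] norm_ge_zero[of x] by (simp del: norm_ge_zero)
      also note one_plus_norm_sq_shift[of x y]
      finally have "norm x ^ k \<le> (2 * (1 + (norm y)\<^sup>2)) ^ k * (1 + (norm (x + y))\<^sup>2) ^ k"
        by (subst power_mult_distrib[symmetric], intro power_mono) auto
      then have "norm x ^ k * norm (f (x + y)) \<le> (2 * (1 + (norm y)\<^sup>2)) ^ k * (1 + (norm (x + y))\<^sup>2) ^ k * norm (f (x + y))"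
        by (intro mult_right_mono) auto
      also have "\<dots> \<le> (2 * (1 + (norm y)\<^sup>2)) ^ k * B"
        unfolding mult.assoc by (intro mult_left_mono B) auto
      finally show ?thesis .
    qed
    then show "\<exists>B. \<forall>x. norm x ^ k * norm (f (x + y)) \<le> B" by blast
    assume b: "b \<in> (Basis :: 'a set)"
    show "\<exists>fa. partial_deriv b (\<lambda>x. f (x + y)) = (\<lambda>x. fa (x + y)) \<and> fa \<in> schwartz"
      using schwartz_partial_deriv[OF f b] by (auto simp: fun_eq_iff partial_deriv_shift)
  qed
  then show ?thesis using assms by blast
qed

lemma laplacian_shift: "laplacian (\<lambda>x. f (x + y)) = (\<lambda>x. laplacian f (x + y))"
  by (simp add: laplacian_def fun_eq_iff partial_deriv_shift[abs_def])

lemma schwartz_continuous: "f \<in> schwartz \<Longrightarrow> continuous_on UNIV f"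
  by (meson continuous_at_imp_continuous_on differentiable_imp_continuous_within schwartz_differentiable)

lemma schwartz_measurable [measurable_dest]: "f \<in> schwartz \<Longrightarrow> f \<in> borel_measurable borel"
  by (intro borel_measurable_continuous_onI schwartz_continuous)

lemma integrable_weight_1D: "integrable lborel (\<lambda>t::real. 1 / (1 + t\<^sup>2))"
proof -
  have "set_integrable lborel (einterval (-\<infinity>) \<infinity>) (\<lambda>t::real. 1 / (1 + t\<^sup>2))"
  proof (rule interval_integral_FTC_nonneg(1)[where F=arctan and A="- (pi/2)" and B="pi/2"])
    show "((arctan \<circ> real_of_ereal) \<longlongrightarrow> pi / 2) (at_left \<infinity>)"
      by (simp add: ereal_tendsto_simps1 tendsto_arctan_at_top)
    show "((arctan \<circ> real_of_ereal) \<longlongrightarrow> - (pi / 2)) (at_right (-\<infinity>))"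
      by (simp add: ereal_tendsto_simps1 tendsto_arctan_at_bot)
    show "DERIV arctan t :> 1 / (1 + t\<^sup>2)" for t
      by (auto intro!: derivative_eq_intros simp: divide_inverse)
    show "isCont (\<lambda>t::real. 1 / (1 + t\<^sup>2)) t" for t
      by (auto intro!: continuous_intros simp: add_nonneg_eq_0_iff)
  qed (auto simp: add_pos_nonneg)
  then show ?thesis by (simp add: set_integrable_def einterval_def)
qed

text \<open>Each factor of \<open>(1 + |x|\<^sup>2)\<^sup>n\<close> dominates one of the \<open>1 + x\<^sub>b\<^sup>2\<close>, which reduces the claim to a
  product of one-dimensional integrals.\<close>

lemma integrable_one_plus_norm_sq:
  "integrable lborel (\<lambda>x::'a::euclidean_space. 1 / (1 + (norm x)\<^sup>2) ^ DIM('a))"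
proof (rule Bochner_Integration.integrable_bound)
  let ?W = "\<lambda>x::'a. (\<Prod>b\<in>Basis. complex_of_real (1 / (1 + (x \<bullet> b)\<^sup>2)))"
  show "integrable lborel ?W"
    by (rule lborel_integral_prod(1)) (intro integrable_of_real integrable_weight_1D)
  have "1 / (1 + (norm x)\<^sup>2) ^ DIM('a) \<le> (\<Prod>b\<in>Basis. 1 / (1 + (x \<bullet> b)\<^sup>2))" for x :: 'a
  proof -
    have "1 / (1 + (norm x)\<^sup>2) ^ DIM('a) = (\<Prod>b\<in>(Basis::'a set). 1 / (1 + (norm x)\<^sup>2))"
      by (simp add: power_divide)
    also have "\<dots> \<le> (\<Prod>b\<in>Basis. 1 / (1 + (x \<bullet> b)\<^sup>2))"
    proof (intro prod_mono conjI divide_left_mono)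
      fix b :: 'a assume "b \<in> Basis"
      then have "\<bar>x \<bullet> b\<bar>\<^sup>2 \<le> (norm x)\<^sup>2" by (intro power_mono Basis_le_norm) auto
      then show "1 + (x \<bullet> b)\<^sup>2 \<le> 1 + (norm x)\<^sup>2" by simp
    qed (auto simp: add_pos_nonneg)
    finally show ?thesis .
  qed
  moreover have "norm (?W x) = (\<Prod>b\<in>Basis. 1 / (1 + (x \<bullet> b)\<^sup>2))" for x
    by (subst of_real_prod[symmetric], subst norm_of_real) (auto simp: prod_nonneg)
  ultimately show "AE x in lborel. norm (1 / (1 + (norm x)\<^sup>2) ^ DIM('a)) \<le> norm (?W x)"
    by (simp add: add_nonneg_nonneg)
qed measurable

lemma integrable_of_decay:
  fixes f :: "'a::euclidean_space \<Rightarrow> complex"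
  assumes [measurable]: "f \<in> borel_measurable borel"
    and B: "\<And>x. (1 + (norm x)\<^sup>2) ^ DIM('a) * norm (f x) \<le> B"
  shows "integrable lborel f"
proof (rule Bochner_Integration.integrable_bound)
  show "integrable lborel (\<lambda>x::'a. B * (1 / (1 + (norm x)\<^sup>2) ^ DIM('a)))"
    by (intro integrable_mult_right integrable_one_plus_norm_sq)
  have "B \<ge> 0" using B[of 0] order_trans[OF norm_ge_zero] by auto
  moreover have "norm (f x) \<le> B * (1 / (1 + (norm x)\<^sup>2) ^ DIM('a))" for x
    using B[of x] by (simp add: field_simps add_pos_nonneg)
  ultimately show "AE x in lborel. norm (f x) \<le> norm (B * (1 / (1 + (norm x)\<^sup>2) ^ DIM('a)))"
    by (auto simp: add_nonneg_nonneg)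
qed simp

lemma schwartz_integrable:
  fixes f :: "'a::euclidean_space \<Rightarrow> complex"
  assumes "f \<in> schwartz"
  shows "integrable lborel f"
proof -
  obtain B where "\<And>x. (1 + (norm x)\<^sup>2) ^ DIM('a) * norm (f x) \<le> B" using schwartz_decay[OF assms] by metis
  then show ?thesis using assms by (intro integrable_of_decay) auto
qed

section \<open>The Fourier transform of a Schwartz function\<close>

text \<open>The mean value theorem bounds the increment by the derivative at an intermediate point, at distance at
  most 1 from \<open>x\<close>; there \<open>1 + |\<sqdot>|\<^sup>2\<close> is at least a quarter of its value at \<open>x\<close>.\<close>

lemma schwartz_difference_quotient_bound:
  fixes f :: "'a::euclidean_space \<Rightarrow> complex"
  assumes f: "f \<in> schwartz" and b: "b \<in> Basis"
  shows "\<exists>C. \<forall>x h. \<bar>h\<bar> \<le> 1 \<longrightarrow> norm (f (x + h *\<^sub>R b) - f x) \<le> \<bar>h\<bar> * (C * (1 / (1 + (norm x)\<^sup>2) ^ DIM('a)))"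
proof -
  obtain B where B0: "B \<ge> 0"
    and B: "\<And>x. (1 + (norm x)\<^sup>2) ^ DIM('a) * norm (partial_deriv b f x) \<le> B"
    using schwartz_decay[OF schwartz_partial_deriv[OF f b]] by metis
  have "norm (f (x + h *\<^sub>R b) - f x) \<le> \<bar>h\<bar> * (4 ^ DIM('a) * B * (1 / (1 + (norm x)\<^sup>2) ^ DIM('a)))"
    if h: "\<bar>h\<bar> \<le> 1" for x h
  proof -
    define g where "g t = f (x + (t * h) *\<^sub>R b)" for t
    have g: "(g has_derivative (\<lambda>s. frechet_derivative f (at (x + (t * h) *\<^sub>R b)) ((s * h) *\<^sub>R b))) (at t)" for t
      unfolding g_def
      by (rule has_derivative_compose[OF _ schwartz_has_derivative[OF f]])
         (auto intro!: derivative_eq_intros)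
    have "\<exists>t\<in>{0<..<1::real}. norm (g 1 - g 0) \<le> norm (frechet_derivative f (at (x + (t * h) *\<^sub>R b)) (((1 - 0) * h) *\<^sub>R b))"
      by (rule mvt_general) (use g in \<open>auto intro!: continuous_at_imp_continuous_on has_derivative_continuous\<close>)
    then obtain t where t: "0 < t" "t < 1"
      and le: "norm (g 1 - g 0) \<le> norm (frechet_derivative f (at (x + (t * h) *\<^sub>R b)) (h *\<^sub>R b))" by auto
    have lin: "linear (frechet_derivative f (at y))" for y
      using schwartz_has_derivative[OF f, of y] by (rule has_derivative_linear)
    let ?y = "x + (t * h) *\<^sub>R b"
    have "norm (g 1 - g 0) \<le> \<bar>h\<bar> * norm (partial_deriv b f ?y)"
      using le by (simp add: linear_scale[OF lin] partial_deriv_def)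
    also have "\<dots> \<le> \<bar>h\<bar> * (4 ^ DIM('a) * B * (1 / (1 + (norm x)\<^sup>2) ^ DIM('a)))"
    proof (intro mult_left_mono)
      have "norm ((t * h) *\<^sub>R b) \<le> 1" using t h b by (simp add: abs_mult mult_le_one)
      then have "(norm ((t * h) *\<^sub>R b))\<^sup>2 \<le> 1" by (simp add: power_le_one)
      then have "2 * (1 + (norm ((t * h) *\<^sub>R b))\<^sup>2) * (1 + (norm ?y)\<^sup>2) \<le> 4 * (1 + (norm ?y)\<^sup>2)"
        by (intro mult_right_mono) auto
      with one_plus_norm_sq_shift[of x "(t * h) *\<^sub>R b"]
      have "1 + (norm x)\<^sup>2 \<le> 4 * (1 + (norm ?y)\<^sup>2)" by linarith
      then have "(1 + (norm x)\<^sup>2) ^ DIM('a) \<le> 4 ^ DIM('a) * (1 + (norm ?y)\<^sup>2) ^ DIM('a)"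
        by (subst power_mult_distrib[symmetric], intro power_mono) auto
      then have "(1 + (norm x)\<^sup>2) ^ DIM('a) * norm (partial_deriv b f ?y) \<le>
          4 ^ DIM('a) * (1 + (norm ?y)\<^sup>2) ^ DIM('a) * norm (partial_deriv b f ?y)"
        by (intro mult_right_mono) auto
      also have "\<dots> \<le> 4 ^ DIM('a) * B" using B[of ?y] by (simp add: mult.assoc)
      finally show "norm (partial_deriv b f ?y) \<le> 4 ^ DIM('a) * B * (1 / (1 + (norm x)\<^sup>2) ^ DIM('a))"
        by (simp add: field_simps add_pos_nonneg)
    qed simp
    finally show ?thesis by (simp add: g_def)
  qed
  then show ?thesis by blast
qed

lemma has_vector_derivative_at_0_iff:
  "(F has_vector_derivative D) (at 0) \<longleftrightarrow> ((\<lambda>h. (F h - F 0) /\<^sub>R h) \<longlongrightarrow> D) (at 0)"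
proof -
  have "((\<lambda>h. norm (F (0 + h) - F 0 - h *\<^sub>R D) / norm h) \<longlongrightarrow> 0) (at 0) \<longleftrightarrow>
      ((\<lambda>h. norm ((F h - F 0) /\<^sub>R h - D)) \<longlongrightarrow> 0) (at 0)"
  proof (intro filterlim_cong refl)
    have "norm (F (0 + h) - F 0 - h *\<^sub>R D) / norm h = norm ((F h - F 0) /\<^sub>R h - D)" if "h \<noteq> 0" for h
    proof -
      have "(F h - F 0) /\<^sub>R h - D = (F h - F 0 - h *\<^sub>R D) /\<^sub>R h"
        using that by (simp add: scaleR_diff_right)
      then show ?thesis by (simp add: divide_inverse mult.commute)
    qed
    then show "\<forall>\<^sub>F h in at 0. norm (F (0 + h) - F 0 - h *\<^sub>R D) / norm h = norm ((F h - F 0) /\<^sub>R h - D)"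
      by (simp add: eventually_at_filter)
  qed
  then show ?thesis
    by (simp add: has_vector_derivative_def has_derivative_at bounded_linear_scaleR_left
        tendsto_norm_zero_iff LIM_zero_iff del: add_0)
qed

lemma schwartz_difference_quotient_tendsto:
  fixes f :: "'a::euclidean_space \<Rightarrow> complex"
  assumes f: "f \<in> schwartz"
  shows "((\<lambda>h. (f (x + h *\<^sub>R b) - f x) /\<^sub>R h) \<longlongrightarrow> partial_deriv b f x) (at 0)"
proof -
  have "((\<lambda>h. f (x + h *\<^sub>R b)) has_derivative (\<lambda>h. frechet_derivative f (at (x + 0 *\<^sub>R b)) (h *\<^sub>R b))) (at 0)"
    by (rule has_derivative_compose[OF _ schwartz_has_derivative[OF f]])
       (auto intro!: derivative_eq_intros)
  moreover have "linear (frechet_derivative f (at x))"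
    using schwartz_has_derivative[OF f, of x] by (rule has_derivative_linear)
  ultimately have "((\<lambda>h. f (x + h *\<^sub>R b)) has_vector_derivative partial_deriv b f x) (at 0)"
    by (simp add: has_vector_derivative_def linear_scale partial_deriv_def)
  then show ?thesis
    by (simp add: has_vector_derivative_at_0_iff)
qed

text \<open>The difference quotients are dominated by a fixed multiple of \<open>(1 + |x|\<^sup>2)\<^sup>-\<^sup>n\<close>, so that
  dominated convergence applies.\<close>

lemma has_vector_derivative_integral_schwartz:
  fixes f a :: "'a::euclidean_space \<Rightarrow> complex"
  assumes f: "f \<in> schwartz" and b: "b \<in> Basis"
    and a[measurable]: "a \<in> borel_measurable borel" and K: "\<And>x. norm (a x) \<le> K"
  shows "((\<lambda>h. LINT x|lborel. a x * f (x + h *\<^sub>R b)) has_vector_derivative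
           (LINT x|lborel. a x * partial_deriv b f x)) (at 0)"
proof -
  have [measurable]: "f \<in> borel_measurable borel" "partial_deriv b f \<in> borel_measurable borel"
    using f b by (auto intro: schwartz_measurable schwartz_partial_deriv)
  obtain C where C: "\<And>x h. \<bar>h\<bar> \<le> 1 \<Longrightarrow> norm (f (x + h *\<^sub>R b) - f x) \<le> \<bar>h\<bar> * (C * (1 / (1 + (norm x)\<^sup>2) ^ DIM('a)))"
    using schwartz_difference_quotient_bound[OF f b] by metis
  let ?F = "\<lambda>h. LINT x|lborel. a x * f (x + h *\<^sub>R b)"
  let ?q = "\<lambda>h x. a x * ((f (x + h *\<^sub>R b) - f x) /\<^sub>R h)"
  have int: "integrable lborel (\<lambda>x. a x * f (x + y))" for y
    by (rule integrable_mult_bounded[where B=K]) (auto intro: schwartz_integrable schwartz_shift f K)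
  have eq: "(?F h - ?F 0) /\<^sub>R h = (LINT x|lborel. ?q h x)" for h
  proof -
    have "(LINT x|lborel. ?q h x) = (LINT x|lborel. (a x * f (x + h *\<^sub>R b) - a x * f (x + 0 *\<^sub>R b)) /\<^sub>R h)"
      by (intro Bochner_Integration.integral_cong) (auto simp: algebra_simps)
    also have "\<dots> = (?F h - ?F 0) /\<^sub>R h"
      by (subst integral_scaleR_right, subst Bochner_Integration.integral_diff) (use int[of 0] in \<open>auto intro: int\<close>)
    finally show ?thesis by (rule sym)
  qed
  have "((\<lambda>h. LINT x|lborel. ?q h x) \<longlongrightarrow> (LINT x|lborel. a x * partial_deriv b f x)) (at 0 within {-1<..<1})"
    unfolding tendsto_at_iff_sequentially comp_def
  proof (intro allI impI)
    fix X :: "nat \<Rightarrow> real" assume X: "\<forall>i. X i \<in> {-1<..<1} - {0}" "X \<longlonglongrightarrow> 0"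
    show "(\<lambda>i. LINT x|lborel. ?q (X i) x) \<longlonglongrightarrow> (LINT x|lborel. a x * partial_deriv b f x)"
    proof (rule integral_dominated_convergence)
      show "integrable lborel (\<lambda>x::'a. K * (C * (1 / (1 + (norm x)\<^sup>2) ^ DIM('a))))"
        by (intro integrable_mult_right integrable_one_plus_norm_sq)
      show "AE x in lborel. (\<lambda>i. ?q (X i) x) \<longlonglongrightarrow> a x * partial_deriv b f x"
      proof (intro AE_I2 tendsto_mult tendsto_const)
        fix x
        from schwartz_difference_quotient_tendsto[OF f, of x b]
        show "(\<lambda>i. (f (x + X i *\<^sub>R b) - f x) /\<^sub>R X i) \<longlonglongrightarrow> partial_deriv b f x"
          using X by (auto simp: tendsto_at_iff_sequentially comp_def)
      qed
      fix i
      show "AE x in lborel. norm (?q (X i) x) \<le> K * (C * (1 / (1 + (norm x)\<^sup>2) ^ DIM('a)))"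
      proof (intro AE_I2)
        fix x
        have Xi: "X i \<noteq> 0" "\<bar>X i\<bar> \<le> 1" using X(1)[rule_format, of i] by auto
        have "norm ((f (x + X i *\<^sub>R b) - f x) /\<^sub>R X i) = norm (f (x + X i *\<^sub>R b) - f x) / \<bar>X i\<bar>"
          by (simp add: divide_inverse mult.commute)
        also have "\<dots> \<le> C * (1 / (1 + (norm x)\<^sup>2) ^ DIM('a))"
          using C[OF Xi(2), of x] Xi(1) by (subst pos_divide_le_eq) (auto simp: mult.commute)
        finally show "norm (?q (X i) x) \<le> K * (C * (1 / (1 + (norm x)\<^sup>2) ^ DIM('a)))"
          unfolding norm_mult using order_trans[OF norm_ge_zero K] by (intro mult_mono K) auto
      qed
    qed measurable
  qed
  then have "((\<lambda>h. (?F h - ?F 0) /\<^sub>R h) \<longlongrightarrow> (LINT x|lborel. a x * partial_deriv b f x)) (at 0)"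
    unfolding eq by (subst (asm) at_within_open) auto
  then show ?thesis by (simp add: has_vector_derivative_at_0_iff)
qed

lemma fourier_lborel:
  assumes "f \<in> schwartz"
  shows "fourier f \<xi> = (LINT x|lborel. exp (- (\<i> * of_real (x \<bullet> \<xi>))) * f x)"
  unfolding fourier_def by (rule integral_completion) (use assms in measurable)

lemma norm_exp_minus_i: "norm (exp (- (\<i> * complex_of_real r))) = 1"
  by (simp add: norm_exp_eq_Re)

lemma schwartz_fourier_integrand:
  fixes f :: "'a::euclidean_space \<Rightarrow> complex"
  assumes "f \<in> schwartz"
  shows "integrable lborel (\<lambda>x. exp (- (\<i> * of_real (x \<bullet> \<xi>))) * f x)"
  by (rule integrable_mult_bounded[of _ _ _ 1])
     (use assms in \<open>auto simp: norm_exp_minus_i intro: schwartz_integrable\<close>)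

text \<open>Translating \<open>f\<close> by \<open>h b\<close> multiplies its transform by \<open>exp (i h \<xi>\<^sub>b)\<close>. Differentiating both
  descriptions of the transform of the translate at \<open>h = 0\<close> gives the rule, without integration by parts.\<close>

lemma fourier_partial_deriv:
  fixes f :: "'a::euclidean_space \<Rightarrow> complex"
  assumes f: "f \<in> schwartz" and b: "b \<in> Basis"
  shows "fourier (partial_deriv b f) \<xi> = \<i> * of_real (\<xi> \<bullet> b) * fourier f \<xi>"
proof -
  have [measurable]: "f \<in> borel_measurable borel" by (rule schwartz_measurable[OF f])
  let ?e = "\<lambda>x. exp (- (\<i> * complex_of_real (x \<bullet> \<xi>)))"
  have "((\<lambda>h. LINT x|lborel. ?e x * f (x + h *\<^sub>R b)) has_vector_derivative
           (LINT x|lborel. ?e x * partial_deriv b f x)) (at 0)"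
    by (rule has_vector_derivative_integral_schwartz[OF f b, of _ 1]) (auto simp: norm_exp_minus_i)
  also have "(\<lambda>h. LINT x|lborel. ?e x * f (x + h *\<^sub>R b)) = (\<lambda>h. exp (of_real h * (\<i> * of_real (\<xi> \<bullet> b))) * fourier f \<xi>)"
  proof
    fix h
    have "(LINT x|lborel. ?e x * f (x + h *\<^sub>R b)) = (LINT x|lborel. ?e ((x + h *\<^sub>R b) - h *\<^sub>R b) * f (x + h *\<^sub>R b))"
      by simp
    also have "\<dots> = (LINT x|lborel. ?e (x - h *\<^sub>R b) * f x)"
      by (rule lborel_integral_translate) simp
    also have "\<dots> = (LINT x|lborel. exp (of_real h * (\<i> * of_real (\<xi> \<bullet> b))) * (?e x * f x))"
      by (intro Bochner_Integration.integral_cong refl)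
         (simp add: inner_diff_left algebra_simps inner_commute exp_diff exp_minus field_simps)
    also have "\<dots> = exp (of_real h * (\<i> * of_real (\<xi> \<bullet> b))) * fourier f \<xi>"
      by (simp add: fourier_lborel[OF f])
    finally show "(LINT x|lborel. ?e x * f (x + h *\<^sub>R b)) = exp (of_real h * (\<i> * of_real (\<xi> \<bullet> b))) * fourier f \<xi>" .
  qed
  finally have 1: "((\<lambda>h. exp (of_real h * (\<i> * of_real (\<xi> \<bullet> b))) * fourier f \<xi>) has_vector_derivative
      fourier (partial_deriv b f) \<xi>) (at 0)"
    by (simp add: fourier_lborel[OF schwartz_partial_deriv[OF f b]])
  have "((\<lambda>h. exp (of_real h * (\<i> * of_real (\<xi> \<bullet> b))) * fourier f \<xi>) has_vector_derivative
      \<i> * of_real (\<xi> \<bullet> b) * fourier f \<xi>) (at 0)"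
  proof -
    have "((\<lambda>z. exp (z * (\<i> * of_real (\<xi> \<bullet> b))) * fourier f \<xi>) has_field_derivative
        \<i> * of_real (\<xi> \<bullet> b) * fourier f \<xi>) (at (of_real 0))"
      by (auto intro!: derivative_eq_intros)
    from has_vector_derivative_real_field[OF this] show ?thesis by simp
  qed
  from vector_derivative_unique_at[OF 1 this] show ?thesis .
qed

lemma fourier_add:
  assumes "f \<in> schwartz" "g \<in> schwartz"
  shows "fourier (\<lambda>x. f x + g x) \<xi> = fourier f \<xi> + fourier g \<xi>"
  using assms
  by (subst (1 2 3) fourier_lborel)
     (auto simp: schwartz_add distrib_left intro!: Bochner_Integration.integral_add schwartz_fourier_integrand)

lemma fourier_cmult: "fourier (\<lambda>x. c * f x) \<xi> = c * fourier f \<xi>"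
  unfolding fourier_def by (subst integral_mult_right_zero[symmetric]) (simp add: mult_ac)

lemma fourier_sum:
  fixes f :: "'i \<Rightarrow> 'a::euclidean_space \<Rightarrow> complex"
  assumes "\<And>i. i \<in> I \<Longrightarrow> f i \<in> schwartz"
  shows "fourier (\<lambda>x. \<Sum>i\<in>I. f i x) \<xi> = (\<Sum>i\<in>I. fourier (f i) \<xi>)"
  using assms
proof (induct I rule: infinite_finite_induct)
  case (insert i I)
  then show ?case by (simp add: fourier_add schwartz_sum)
qed (auto simp: fourier_def)

lemma fourier_laplacian:
  fixes f :: "'a::euclidean_space \<Rightarrow> complex"
  assumes f: "f \<in> schwartz"
  shows "fourier (laplacian f) \<xi> = - of_real ((norm \<xi>)\<^sup>2) * fourier f \<xi>"
proof -
  have "fourier (laplacian f) \<xi> = (\<Sum>b\<in>Basis. fourier (partial_deriv b (partial_deriv b f)) \<xi>)"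
    unfolding laplacian_def[abs_def] by (intro fourier_sum schwartz_partial_deriv f)
  also have "\<dots> = (\<Sum>b\<in>Basis. - of_real ((\<xi> \<bullet> b)\<^sup>2) * fourier f \<xi>)"
    by (intro sum.cong refl)
       (simp add: fourier_partial_deriv schwartz_partial_deriv f power2_eq_square, simp add: algebra_simps)
  also have "\<dots> = - of_real ((norm \<xi>)\<^sup>2) * fourier f \<xi>"
    by (simp add: sum_negf sum_distrib_right[symmetric] of_real_sum[symmetric] sum_inner_squares del: of_real_sum of_real_power)
  finally show ?thesis .
qed

text \<open>Multiplication of \<open>f\<close>'s transform by \<open>1 + |\<xi>|\<^sup>2\<close> is the
  transform of the Schwartz function \<open>f - \<Delta>f\<close>, and every transform is bounded.\<close>

lemma fourier_decay:
  fixes f :: "'a::euclidean_space \<Rightarrow> complex"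
  assumes "f \<in> schwartz"
  shows "\<exists>B. \<forall>\<xi>. (1 + (norm \<xi>)\<^sup>2) ^ k * norm (fourier f \<xi>) \<le> B"
  using assms
proof (induct k arbitrary: f)
  case 0
  have "norm (fourier f \<xi>) \<le> (LINT x|lborel. norm (f x))" for \<xi>
    using integral_norm_bound[of lborel "\<lambda>x. exp (- (\<i> * of_real (x \<bullet> \<xi>))) * f x"]
    by (simp add: fourier_lborel[OF 0] norm_mult norm_exp_minus_i)
  then show ?case by auto
next
  case (Suc k)
  let ?g = "\<lambda>x. f x + (-1) * laplacian f x"
  have g: "?g \<in> schwartz" by (intro schwartz_add schwartz_cmult schwartz_laplacian Suc.prems)
  have "fourier ?g \<xi> = of_real (1 + (norm \<xi>)\<^sup>2) * fourier f \<xi>" for \<xi>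
    unfolding fourier_add[OF Suc.prems schwartz_cmult[OF schwartz_laplacian[OF Suc.prems]]]
      fourier_cmult fourier_laplacian[OF Suc.prems]
    by (simp add: algebra_simps)
  then have "norm (fourier ?g \<xi>) = (1 + (norm \<xi>)\<^sup>2) * norm (fourier f \<xi>)" for \<xi>
    by (simp add: norm_mult abs_of_nonneg del: of_real_add of_real_power)
  moreover obtain B where "\<And>\<xi>. (1 + (norm \<xi>)\<^sup>2) ^ k * norm (fourier ?g \<xi>) \<le> B"
    using Suc.hyps[OF g] by metis
  ultimately show ?case by (auto simp: algebra_simps)
qed

lemma fourier_measurable:
  fixes f :: "'a::euclidean_space \<Rightarrow> complex"
  assumes "f \<in> schwartz"
  shows "fourier f \<in> borel_measurable borel"
proof -
  have [measurable]: "f \<in> borel_measurable borel" by (rule schwartz_measurable[OF assms])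
  show ?thesis unfolding fourier_lborel[OF assms, abs_def] by measurable
qed

lemma fourier_multiplier_integrable:
  fixes f :: "'a::euclidean_space \<Rightarrow> complex"
  assumes f: "f \<in> schwartz" and m[measurable]: "m \<in> borel_measurable borel"
    and bound: "\<And>\<xi>. norm (m \<xi>) \<le> 1 + (norm \<xi>)\<^sup>2"
  shows "integrable lborel (\<lambda>\<xi>. m \<xi> * fourier f \<xi>)"
proof -
  obtain B where B: "\<And>\<xi>. (1 + (norm \<xi>)\<^sup>2) ^ (DIM('a) + 1) * norm (fourier f \<xi>) \<le> B"
    using fourier_decay[OF f] by metis
  show ?thesis
  proof (rule integrable_of_decay)
    show "(1 + (norm \<xi>)\<^sup>2) ^ DIM('a) * norm (m \<xi> * fourier f \<xi>) \<le> B" for \<xi>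
    proof -
      have "(1 + (norm \<xi>)\<^sup>2) ^ DIM('a) * norm (m \<xi> * fourier f \<xi>)
          \<le> (1 + (norm \<xi>)\<^sup>2) ^ DIM('a) * ((1 + (norm \<xi>)\<^sup>2) * norm (fourier f \<xi>))"
        unfolding norm_mult by (intro mult_left_mono mult_right_mono bound) auto
      also have "\<dots> \<le> B" using B[of \<xi>] by (simp add: algebra_simps)
      finally show ?thesis .
    qed
  qed (use fourier_measurable[OF f] in measurable)
qed

lemma fourier_integrable:
  assumes "f \<in> schwartz"
  shows "integrable lborel (fourier f)"
  using fourier_multiplier_integrable[OF assms, of "\<lambda>_. 1"] by simp

section \<open>Fourier inversion and averages over translations\<close>

lemma norm_exp_i: "norm (exp (\<i> * complex_of_real r)) = 1"
  by (simp add: norm_exp_eq_Re)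

lemma inverse_fourier_lborel:
  fixes g :: "'a::euclidean_space \<Rightarrow> complex"
  assumes "g \<in> borel_measurable borel"
  shows "inverse_fourier g x =
    complex_of_real (1 / (2 * pi) ^ DIM('a)) * (LINT \<xi>|lborel. exp (\<i> * of_real (x \<bullet> \<xi>)) * g \<xi>)"
  unfolding inverse_fourier_def by (subst integral_completion) (use assms in measurable)

lemma inverse_fourier_integrand:
  fixes g :: "'a::euclidean_space \<Rightarrow> complex"
  assumes "integrable lborel g"
  shows "integrable lborel (\<lambda>\<xi>. exp (\<i> * of_real (x \<bullet> \<xi>)) * g \<xi>)"
  by (rule integrable_mult_bounded[of _ _ _ 1]) (use assms in \<open>auto simp: norm_exp_i\<close>)

lemma inverse_fourier_diff:
  fixes g h :: "'a::euclidean_space \<Rightarrow> complex"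
  assumes g: "integrable lborel g" and h: "integrable lborel h"
  shows "inverse_fourier (\<lambda>\<xi>. g \<xi> - h \<xi>) x = inverse_fourier g x - inverse_fourier h x"
proof -
  have m: "g \<in> borel_measurable borel" "h \<in> borel_measurable borel" using g h by auto
  then have "(\<lambda>\<xi>. g \<xi> - h \<xi>) \<in> borel_measurable borel" by measurable
  then show ?thesis
    using m inverse_fourier_integrand[OF g, of x] inverse_fourier_integrand[OF h, of x]
    by (simp add: inverse_fourier_lborel right_diff_distrib Bochner_Integration.integral_diff)
qed

lemma inverse_fourier_cmult: "inverse_fourier (\<lambda>\<xi>. c * g \<xi>) x = c * inverse_fourier g x"
proof -
  have "(LINT \<xi>|lebesgue. exp (\<i> * of_real (x \<bullet> \<xi>)) * (c * g \<xi>)) =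
      c * (LINT \<xi>|lebesgue. exp (\<i> * of_real (x \<bullet> \<xi>)) * g \<xi>)"
    by (subst integral_mult_right_zero[symmetric]) (simp add: mult_ac)
  then show ?thesis by (simp add: inverse_fourier_def mult_ac)
qed

text \<open>Fubini's theorem with the Gaussian written as its own Fourier transform.\<close>

lemma gaussian_mollification_eq:
  fixes f :: "'a::euclidean_space \<Rightarrow> complex"
  assumes f: "f \<in> schwartz" and e: "e > 0"
  shows "(LINT z|gauss_measure. f (x - e *\<^sub>R z)) = of_real (1 / (2 * pi) ^ DIM('a)) *
    (LINT \<eta>|lborel. of_real (exp (- (norm (e *\<^sub>R \<eta>))\<^sup>2 / 2)) * (exp (\<i> * of_real (x \<bullet> \<eta>)) * fourier f \<eta>))"
proof -
  interpret G: prob_space "gauss_measure :: 'a measure" by (rule prob_space_gauss)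
  interpret Q: pair_sigma_finite lborel "gauss_measure :: 'a measure" ..
  have [measurable]: "f \<in> borel_measurable borel" "fourier f \<in> borel_measurable borel"
    using f by (auto intro: schwartz_measurable fourier_measurable)
  define s where "s = 1 / sqrt (2 * pi) ^ DIM('a)"
  have s2: "s * s = 1 / (2 * pi) ^ DIM('a)"
  proof -
    have "sqrt (2 * pi) ^ DIM('a) * sqrt (2 * pi) ^ DIM('a) = (sqrt (2 * pi) * sqrt (2 * pi)) ^ DIM('a)"
      by (rule power_mult_distrib[symmetric])
    also have "\<dots> = (2 * pi) ^ DIM('a)" by (subst real_sqrt_mult_self) simp
    finally show ?thesis by (simp only: s_def times_divide_times_eq mult_1)
  qed
  define G where "G \<eta> = exp (\<i> * of_real (x \<bullet> \<eta>)) * fourier f \<eta>" for \<eta>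
  have [measurable]: "G \<in> borel_measurable borel" unfolding G_def by measurable
  have gauss: "complex_of_real (std_gauss z) = of_real s * (LINT \<xi>|gauss_measure. exp (\<i> * of_real (z \<bullet> \<xi>)))" for z :: 'a
  proof -
    have "(LINT \<xi>|gauss_measure. exp (\<i> * of_real (z \<bullet> \<xi>))) = of_real (exp (- (norm z)\<^sup>2 / 2))"
      using gauss_measure_charfun[of z] by (simp only: inner_commute)
    then show ?thesis by (simp add: std_gauss_eq s_def)
  qed
  have fe: "integrable lborel (\<lambda>z. f (x - e *\<^sub>R z))"
    using lborel_integral_affine(1)[of "-e" f x] schwartz_integrable[OF f] e by simp
  have inner: "(LINT z|lborel. exp (\<i> * of_real (z \<bullet> \<xi>)) * f (x - e *\<^sub>R z)) = (1 / e ^ DIM('a)) *\<^sub>R G ((1 / e) *\<^sub>R \<xi>)" for \<xi>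
  proof -
    define F where "F y = exp (\<i> * of_real (((1 / e) *\<^sub>R (x - y)) \<bullet> \<xi>)) * f y" for y
    have [measurable]: "F \<in> borel_measurable borel" unfolding F_def by measurable
    have "(LINT y|lborel. F y) = e ^ DIM('a) *\<^sub>R (LINT z|lborel. F (x + (- e) *\<^sub>R z))"
      using lborel_integral_affine(2)[of "- e" F x] e by simp
    moreover have "F (x + (- e) *\<^sub>R z) = exp (\<i> * of_real (z \<bullet> \<xi>)) * f (x - e *\<^sub>R z)" for z
      using e by (simp add: F_def)
    moreover have "(LINT y|lborel. F y) = G ((1 / e) *\<^sub>R \<xi>)"
    proof -
      have "F y = exp (\<i> * of_real (x \<bullet> ((1 / e) *\<^sub>R \<xi>))) * (exp (- (\<i> * of_real (y \<bullet> ((1 / e) *\<^sub>R \<xi>)))) * f y)" for y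
      proof -
        have "\<i> * of_real (((1 / e) *\<^sub>R (x - y)) \<bullet> \<xi>) =
            \<i> * of_real (x \<bullet> ((1 / e) *\<^sub>R \<xi>)) + - (\<i> * complex_of_real (y \<bullet> ((1 / e) *\<^sub>R \<xi>)))"
          by (simp add: inner_diff_left right_diff_distrib diff_divide_distrib)
        then show ?thesis unfolding F_def by (simp only: exp_add mult.assoc)
      qed
      then show ?thesis by (simp only: G_def fourier_lborel[OF f] integral_mult_right_zero)
    qed
    ultimately show ?thesis using e by simp
  qed
  have "(LINT z|gauss_measure. f (x - e *\<^sub>R z)) = (LINT z|lborel. of_real (std_gauss z) * f (x - e *\<^sub>R z))"
    by (rule gauss_measure_integral) measurable
  also have "\<dots> = (LINT z|lborel. of_real s * (LINT \<xi>|gauss_measure. exp (\<i> * of_real (z \<bullet> \<xi>)) * f (x - e *\<^sub>R z)))"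
    by (intro Bochner_Integration.integral_cong refl, subst gauss)
       (simp only: mult.assoc integral_mult_left_zero)
  also have "\<dots> = of_real s * (LINT z|lborel. LINT \<xi>|gauss_measure. exp (\<i> * of_real (z \<bullet> \<xi>)) * f (x - e *\<^sub>R z))"
    by (rule integral_mult_right_zero)
  also have "(LINT z|lborel. LINT \<xi>|gauss_measure. exp (\<i> * of_real (z \<bullet> \<xi>)) * f (x - e *\<^sub>R z)) =
      (LINT \<xi>|gauss_measure. LINT z|lborel. exp (\<i> * of_real (z \<bullet> \<xi>)) * f (x - e *\<^sub>R z))"
  proof (rule Q.Fubini_integral[symmetric])
    have "integrable (lborel \<Otimes>\<^sub>M gauss_measure)
        (\<lambda>(z, \<xi>). (\<lambda>(z, \<xi>). exp (\<i> * of_real (z \<bullet> \<xi>))) (z, \<xi>) * f (x - e *\<^sub>R z))"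
      by (rule integrable_pair_mult_bounded[where B=1, OF sigma_finite_lborel prob_space_gauss fe])
         (auto simp: norm_exp_i)
    then show "integrable (lborel \<Otimes>\<^sub>M gauss_measure) (\<lambda>(z, \<xi>). exp (\<i> * of_real (z \<bullet> \<xi>)) * f (x - e *\<^sub>R z))"
      by simp
  qed
  also have "\<dots> = (LINT \<xi>|gauss_measure. (1 / e ^ DIM('a)) *\<^sub>R G ((1 / e) *\<^sub>R \<xi>))"
    by (simp only: inner)
  also have "\<dots> = (1 / e ^ DIM('a)) *\<^sub>R (LINT \<xi>|lborel. of_real (std_gauss \<xi>) * G ((1 / e) *\<^sub>R \<xi>))"
    by (subst integral_scaleR_right, subst gauss_measure_integral) auto
  also have "(LINT \<xi>|lborel. of_real (std_gauss \<xi>) * G ((1 / e) *\<^sub>R \<xi>)) =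
      e ^ DIM('a) *\<^sub>R (LINT \<eta>|lborel. of_real (std_gauss (e *\<^sub>R \<eta>)) * G \<eta>)"
    using e by (subst lborel_integral_affine(2)[of e _ 0]) auto
  also have "(LINT \<eta>|lborel. of_real (std_gauss (e *\<^sub>R \<eta>)) * G \<eta>) =
      (LINT \<eta>|lborel. of_real s * (of_real (exp (- (norm (e *\<^sub>R \<eta>))\<^sup>2 / 2)) * G \<eta>))"
    by (simp add: std_gauss_eq s_def)
  also have "\<dots> = of_real s * (LINT \<eta>|lborel. of_real (exp (- (norm (e *\<^sub>R \<eta>))\<^sup>2 / 2)) * G \<eta>)" (is "_ = _ * ?I")
    by (rule integral_mult_right_zero)
  also have "of_real s * ((1 / e ^ DIM('a)) *\<^sub>R (e ^ DIM('a) *\<^sub>R (of_real s * ?I))) = of_real (s * s) * ?I"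
    using e by simp
  finally show ?thesis unfolding s2 G_def .
qed

text \<open>Both sides of the mollified identity \<open>gaussian_mollification_eq\<close> converge as the width tends to 0,
  the left one because \<open>f\<close> is bounded and continuous, the right one because the transform of \<open>f\<close> is
  integrable.\<close>

theorem fourier_inversion:
  fixes f :: "'a::euclidean_space \<Rightarrow> complex"
  assumes f: "f \<in> schwartz"
  shows "inverse_fourier (fourier f) x = f x"
proof -
  interpret G: prob_space "gauss_measure :: 'a measure" by (rule prob_space_gauss)
  have [measurable]: "f \<in> borel_measurable borel" "fourier f \<in> borel_measurable borel"
    using f by (auto intro: schwartz_measurable fourier_measurable)
  obtain B where B: "\<And>x. norm (f x) \<le> B" using schwartz_bounded[OF f] by metis
  define X where "X n = 1 / real (Suc n)" for n
  have X: "X \<longlonglongrightarrow> 0" unfolding X_def by (rule LIMSEQ_Suc[OF lim_1_over_n])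
  let ?G = "\<lambda>\<eta>. exp (\<i> * of_real (x \<bullet> \<eta>)) * fourier f \<eta>"
  have G: "integrable lborel ?G" by (intro inverse_fourier_integrand fourier_integrable f)
  have lim1: "(\<lambda>n. LINT z|gauss_measure. f (x - X n *\<^sub>R z)) \<longlonglongrightarrow> (LINT z|(gauss_measure :: 'a measure). f x)"
  proof (rule integral_dominated_convergence)
    show "AE z in gauss_measure. (\<lambda>n. f (x - X n *\<^sub>R z)) \<longlonglongrightarrow> f x"
    proof (rule AE_I2)
      fix z
      have "(\<lambda>n. x - X n *\<^sub>R z) \<longlonglongrightarrow> x - 0 *\<^sub>R z" by (intro tendsto_intros X)
      then have "(\<lambda>n. x - X n *\<^sub>R z) \<longlonglongrightarrow> x" by simp
      moreover have "isCont f x" using schwartz_continuous[OF f] by (simp add: continuous_on_eq_continuous_at)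
      ultimately show "(\<lambda>n. f (x - X n *\<^sub>R z)) \<longlonglongrightarrow> f x" by (rule isCont_tendsto_compose[rotated])
    qed
    show "AE z in gauss_measure. norm (f (x - X n *\<^sub>R z)) \<le> B" for n using B by simp
  qed auto
  have const: "(LINT z|(gauss_measure :: 'a measure). f x) = f x" using G.prob_space by simp
  have "(\<lambda>n. LINT \<eta>|lborel. of_real (exp (- (norm (X n *\<^sub>R \<eta>))\<^sup>2 / 2)) * ?G \<eta>) \<longlonglongrightarrow> (LINT \<eta>|lborel. ?G \<eta>)"
  proof (rule integral_dominated_convergence)
    show "AE \<eta> in lborel. (\<lambda>n. of_real (exp (- (norm (X n *\<^sub>R \<eta>))\<^sup>2 / 2)) * ?G \<eta>) \<longlonglongrightarrow> ?G \<eta>"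
    proof (rule AE_I2)
      fix \<eta> :: 'a
      have "(\<lambda>n. complex_of_real (exp (- (norm (X n *\<^sub>R \<eta>))\<^sup>2 / 2)) * ?G \<eta>) \<longlonglongrightarrow>
          complex_of_real (exp (- (norm (0 *\<^sub>R \<eta>))\<^sup>2 / 2)) * ?G \<eta>"
        by (intro tendsto_intros X) simp
      then show "(\<lambda>n. of_real (exp (- (norm (X n *\<^sub>R \<eta>))\<^sup>2 / 2)) * ?G \<eta>) \<longlonglongrightarrow> ?G \<eta>" by simp
    qed
    show "AE \<eta> in lborel. norm (of_real (exp (- (norm (X n *\<^sub>R \<eta>))\<^sup>2 / 2)) * ?G \<eta>) \<le> norm (?G \<eta>)" for n
      by (auto simp: norm_mult intro!: mult_left_le_one_le)
    show "integrable lborel (\<lambda>\<eta>. norm (?G \<eta>))" using G by (rule integrable_norm)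
  qed auto
  then have lim2: "(\<lambda>n. of_real (1 / (2 * pi) ^ DIM('a)) * (LINT \<eta>|lborel. of_real (exp (- (norm (X n *\<^sub>R \<eta>))\<^sup>2 / 2)) * ?G \<eta>))
      \<longlonglongrightarrow> inverse_fourier (fourier f) x"
    unfolding inverse_fourier_lborel[OF fourier_measurable[OF f]] by (rule tendsto_mult_left)
  have eq: "(LINT z|gauss_measure. f (x - X n *\<^sub>R z)) =
      of_real (1 / (2 * pi) ^ DIM('a)) * (LINT \<eta>|lborel. of_real (exp (- (norm (X n *\<^sub>R \<eta>))\<^sup>2 / 2)) * ?G \<eta>)" for n
    by (rule gaussian_mollification_eq[OF f]) (simp add: X_def)
  show ?thesis using LIMSEQ_unique[OF lim2 lim1[unfolded eq const]] .
qed

text \<open>Averaging the translates of a Schwartz function over a random shift is a Fourier multiplier: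
  the multiplier is the characteristic function of the shift.\<close>

lemma average_translates_fourier:
  fixes f :: "'a::euclidean_space \<Rightarrow> complex" and Z :: "'w \<Rightarrow> 'a"
  assumes f: "f \<in> schwartz" and P: "prob_space P" and Z[measurable]: "Z \<in> P \<rightarrow>\<^sub>M borel"
  shows "(LINT w|P. f (x - Z w)) =
    inverse_fourier (\<lambda>\<xi>. (LINT w|P. exp (- (\<i> * of_real (Z w \<bullet> \<xi>)))) * fourier f \<xi>) x"
proof -
  interpret P: prob_space P by fact
  interpret Q: pair_sigma_finite lborel P ..
  have [measurable]: "fourier f \<in> borel_measurable borel" using f by (rule fourier_measurable)
  have "(LINT w|P. f (x - Z w)) =
      (LINT w|P. of_real (1 / (2 * pi) ^ DIM('a)) * (LINT \<xi>|lborel. exp (\<i> * of_real ((x - Z w) \<bullet> \<xi>)) * fourier f \<xi>))"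
    by (intro Bochner_Integration.integral_cong refl)
       (simp only: inverse_fourier_lborel[OF fourier_measurable[OF f], symmetric] fourier_inversion[OF f])
  also have "\<dots> = of_real (1 / (2 * pi) ^ DIM('a)) * (LINT w|P. LINT \<xi>|lborel. exp (\<i> * of_real ((x - Z w) \<bullet> \<xi>)) * fourier f \<xi>)"
    by (rule integral_mult_right_zero)
  also have "(LINT w|P. LINT \<xi>|lborel. exp (\<i> * of_real ((x - Z w) \<bullet> \<xi>)) * fourier f \<xi>) =
      (LINT \<xi>|lborel. LINT w|P. exp (\<i> * of_real ((x - Z w) \<bullet> \<xi>)) * fourier f \<xi>)"
  proof (rule Q.Fubini_integral)
    have "integrable (lborel \<Otimes>\<^sub>M P) (\<lambda>(\<xi>, w). (\<lambda>(\<xi>, w). exp (\<i> * of_real ((x - Z w) \<bullet> \<xi>))) (\<xi>, w) * fourier f \<xi>)"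
      by (rule integrable_pair_mult_bounded[where B=1, OF sigma_finite_lborel P fourier_integrable[OF f]])
         (auto simp: norm_exp_i)
    then show "integrable (lborel \<Otimes>\<^sub>M P) (\<lambda>(\<xi>, w). exp (\<i> * of_real ((x - Z w) \<bullet> \<xi>)) * fourier f \<xi>)"
      by simp
  qed
  also have "\<dots> = (LINT \<xi>|lborel. exp (\<i> * of_real (x \<bullet> \<xi>)) * ((LINT w|P. exp (- (\<i> * of_real (Z w \<bullet> \<xi>)))) * fourier f \<xi>))"
  proof (intro Bochner_Integration.integral_cong refl)
    fix \<xi>
    have "exp (\<i> * of_real ((x - Z w) \<bullet> \<xi>)) * fourier f \<xi> =
        exp (\<i> * of_real (x \<bullet> \<xi>)) * fourier f \<xi> * exp (- (\<i> * of_real (Z w \<bullet> \<xi>)))" for w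
      by (simp add: inner_diff_left right_diff_distrib exp_diff exp_minus field_simps)
    then show "(LINT w|P. exp (\<i> * of_real ((x - Z w) \<bullet> \<xi>)) * fourier f \<xi>) =
        exp (\<i> * of_real (x \<bullet> \<xi>)) * ((LINT w|P. exp (- (\<i> * of_real (Z w \<bullet> \<xi>)))) * fourier f \<xi>)"
      by (simp only: integral_mult_right_zero) (simp add: mult_ac)
  qed
  also have "of_real (1 / (2 * pi) ^ DIM('a)) * \<dots> =
      inverse_fourier (\<lambda>\<xi>. (LINT w|P. exp (- (\<i> * of_real (Z w \<bullet> \<xi>)))) * fourier f \<xi>) x"
    by (subst inverse_fourier_lborel) measurable
  finally show ?thesis .
qed

section \<open>The fractional Laplacian as an average of resolvents\<close>

text \<open>The exponent is \<open>s - 1\<close> and not \<open>s\<close> because the averages over translations below carry the factor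
  \<open>\<mu>\<close> of \<open>\<mu> / (\<mu> + r)\<close>.\<close>

definition stieltjes_density :: "real \<Rightarrow> real \<Rightarrow> real"
  where "stieltjes_density s \<mu> = indicator {0<..} \<mu> * (\<mu> powr (s - 1) / (\<mu> + 1))"

lemma stieltjes_density_measurable [measurable]: "stieltjes_density s \<in> borel_measurable borel"
  unfolding stieltjes_density_def[abs_def] by measurable

lemma stieltjes_density_nonneg: "stieltjes_density s \<mu> \<ge> 0"
  by (auto simp: stieltjes_density_def indicator_def)

lemma stieltjes_density_integrable:
  assumes "0 < s" "s < 1"
  shows "integrable lborel (stieltjes_density s)"
proof -
  have borel: "integrable lborel (\<lambda>\<mu>. indicator A \<mu> * \<mu> powr e)"
    if I: "((\<lambda>\<mu>::real. \<mu> powr e) has_integral r) A" and A[measurable]: "A \<in> sets borel" for A e r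
  proof -
    have "(\<lambda>\<mu>. \<mu> powr e) absolutely_integrable_on A"
      by (rule nonnegative_absolutely_integrable_1) (use I in \<open>auto simp: integrable_on_def\<close>)
    then have "integrable lebesgue (\<lambda>\<mu>. indicator A \<mu> * \<mu> powr e)" by (simp add: set_integrable_def)
    then show ?thesis by (subst (asm) integrable_completion) auto
  qed
  have "integrable lborel (\<lambda>\<mu>. indicator {0..1} \<mu> * \<mu> powr (s - 1) + indicator {1..} \<mu> * \<mu> powr (s - 2))"
    by (intro Bochner_Integration.integrable_add borel[OF has_integral_powr_from_0] borel[OF has_integral_powr_to_inf])
       (use assms in auto)
  then show ?thesis
  proof (rule Bochner_Integration.integrable_bound)
    have "stieltjes_density s \<mu> \<le> indicator {0..1} \<mu> * \<mu> powr (s - 1) + indicator {1..} \<mu> * \<mu> powr (s - 2)" for \<mu>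
    proof (cases "0 < \<mu>")
      case True
      show ?thesis
      proof (cases "\<mu> \<le> 1")
        case le: True
        have "\<mu> powr (s - 1) / (\<mu> + 1) \<le> \<mu> powr (s - 1) / 1"
          using True by (intro divide_left_mono) auto
        then show ?thesis using True le by (auto simp: stieltjes_density_def indicator_def)
      next
        case False
        have "\<mu> powr (s - 1) / (\<mu> + 1) \<le> \<mu> powr (s - 1) / \<mu>"
          using True by (intro divide_left_mono) auto
        also have "\<dots> = \<mu> powr (s - 2)"
          using True powr_diff[of \<mu> "s - 1" 1] by simp
        finally show ?thesis using True False by (auto simp: stieltjes_density_def indicator_def)
      qed
    qed (auto simp: stieltjes_density_def indicator_def)
    then show "AE \<mu> in lborel. norm (stieltjes_density s \<mu>) \<le>
        norm (indicator {0..1} \<mu> * \<mu> powr (s - 1) + indicator {1..} \<mu> * \<mu> powr (s - 2))"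
      using stieltjes_density_nonneg[of s] by (auto intro: order_trans[OF _ abs_ge_self])
  qed simp
qed

definition stieltjes_const :: "real \<Rightarrow> real"
  where "stieltjes_const s = (LINT \<mu>|lborel. stieltjes_density s \<mu>)"

lemma stieltjes_const_pos:
  assumes "0 < s" "s < 1"
  shows "stieltjes_const s > 0"
proof -
  have "stieltjes_const s \<noteq> 0"
  proof
    assume "stieltjes_const s = 0"
    then have "AE \<mu> in lborel. stieltjes_density s \<mu> = 0"
      unfolding stieltjes_const_def
      by (subst (asm) integral_nonneg_eq_0_iff_AE)
         (auto simp: stieltjes_density_integrable assms stieltjes_density_nonneg)
    then have "AE \<mu> in lborel. \<mu> \<notin> {0<..1::real}"
      by eventually_elim (auto simp: stieltjes_density_def indicator_def split: if_splits)
    then have "{0<..1::real} \<in> null_sets lborel"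
      by (subst AE_iff_null_sets) auto
    then show False by auto
  qed
  moreover have "stieltjes_const s \<ge> 0"
    unfolding stieltjes_const_def by (intro Bochner_Integration.integral_nonneg stieltjes_density_nonneg)
  ultimately show ?thesis by simp
qed

definition stieltjes_measure :: "real \<Rightarrow> real measure"
  where "stieltjes_measure s = density lborel (\<lambda>\<mu>. ennreal (stieltjes_density s \<mu> / stieltjes_const s))"

lemma sets_stieltjes_measure [simp, measurable_cong]: "sets (stieltjes_measure s) = sets borel"
  by (simp add: stieltjes_measure_def)

lemma space_stieltjes_measure [simp]: "space (stieltjes_measure s) = UNIV"
  by (simp add: stieltjes_measure_def)

lemma stieltjes_measure_pos: "AE \<mu> in stieltjes_measure s. \<mu> > 0"
  unfolding stieltjes_measure_def
  by (subst AE_density) (auto simp: stieltjes_density_def indicator_def intro!: AE_I2)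

lemma integral_stieltjes_measure:
  fixes f :: "real \<Rightarrow> real"
  assumes s: "0 < s" "s < 1" and [measurable]: "f \<in> borel_measurable borel"
  shows "(LINT \<mu>|stieltjes_measure s. f \<mu>) = (LINT \<mu>|lborel. stieltjes_density s \<mu> * f \<mu>) / stieltjes_const s"
proof -
  have "(LINT \<mu>|stieltjes_measure s. f \<mu>) = (LINT \<mu>|lborel. (stieltjes_density s \<mu> * f \<mu>) / stieltjes_const s)"
    unfolding stieltjes_measure_def using stieltjes_const_pos[OF s]
    by (subst integral_density) (auto simp: stieltjes_density_nonneg intro!: AE_I2 divide_nonneg_nonneg)
  then show ?thesis by simp
qed

lemma prob_space_stieltjes:
  assumes s: "0 < s" "s < 1"
  shows "prob_space (stieltjes_measure s)"
proof
  have "emeasure (stieltjes_measure s) (space (stieltjes_measure s)) =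
      (\<integral>\<^sup>+\<mu>. ennreal (stieltjes_density s \<mu> / stieltjes_const s) \<partial>lborel)"
    by (simp add: stieltjes_measure_def emeasure_density)
  also have "\<dots> = ennreal (LINT \<mu>|lborel. stieltjes_density s \<mu> / stieltjes_const s)"
    using stieltjes_const_pos[OF s]
    by (intro nn_integral_eq_integral) (auto simp: stieltjes_density_integrable s stieltjes_density_nonneg intro!: AE_I2 divide_nonneg_nonneg)
  also have "(LINT \<mu>|lborel. stieltjes_density s \<mu> / stieltjes_const s) = 1"
    using stieltjes_const_pos[OF s] by (simp add: stieltjes_const_def)
  finally show "emeasure (stieltjes_measure s) (space (stieltjes_measure s)) = 1" by simp
qed

text \<open>This is the Stieltjes representation of \<open>(r\<^sup>s - 1) / (r - 1)\<close>. A partial fraction decomposition turns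
  \<open>(r - 1) \<mu>\<^sup>s / ((\<mu> + 1) (\<mu> + r))\<close> into \<open>r \<mu>\<^sup>s\<^sup>-\<^sup>1 / (\<mu> + r) - \<mu>\<^sup>s\<^sup>-\<^sup>1 / (\<mu> + 1)\<close>, and the substitution
  \<open>\<mu> = r \<nu>\<close> shows that the integral of the first term is \<open>r\<^sup>s\<close> times that of the second.\<close>

lemma stieltjes_representation:
  assumes s: "0 < s" "s < 1" and l: "r \<ge> 0"
  shows "(r - 1) * (LINT \<mu>|stieltjes_measure s. \<mu> / (\<mu> + r)) = r powr s - 1"
proof -
  let ?k = "stieltjes_density s" and ?K = "stieltjes_const s"
  have K: "?K > 0" by (rule stieltjes_const_pos[OF s])
  have int: "integrable lborel ?k" by (rule stieltjes_density_integrable[OF s])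
  have "(r - 1) * (LINT \<mu>|lborel. ?k \<mu> * (\<mu> / (\<mu> + r))) = (r powr s - 1) * ?K"
  proof (cases "r = 0")
    case True
    have "(LINT \<mu>|lborel. ?k \<mu> * (\<mu> / (\<mu> + r))) = ?K"
      unfolding stieltjes_const_def True
      by (intro Bochner_Integration.integral_cong) (auto simp: stieltjes_density_def indicator_def)
    then show ?thesis using True s by simp
  next
    case False
    with l have l: "r > 0" by simp
    define h where "h \<mu> = r powr (s - 1) * ?k (\<mu> / r)" for \<mu>
    have h_int: "integrable lborel h"
      unfolding h_def using lborel_integrable_real_affine_iff[of "1 / r" ?k 0] l int by (intro integrable_mult_right) simp
    have "(LINT \<mu>|lborel. ?k \<mu>) = \<bar>1 / r\<bar> *\<^sub>R (LINT \<mu>|lborel. ?k (0 + (1 / r) * \<mu>))"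
      using l by (intro lborel_integral_real_affine) auto
    then have "(LINT \<mu>|lborel. ?k (\<mu> / r)) = r * ?K"
      using l by (simp add: stieltjes_const_def)
    moreover have "r powr (s - 1) * r = r powr s" using l powr_add[of r "s - 1" 1] by simp
    ultimately have h: "(LINT \<mu>|lborel. h \<mu>) = r powr s * ?K" by (simp add: h_def)
    have "(r - 1) * (?k \<mu> * (\<mu> / (\<mu> + r))) = h \<mu> - ?k \<mu>" for \<mu>
    proof (cases "\<mu> > 0")
      case True
      have "(r - 1) * (p / (\<mu> + 1) * (\<mu> / (\<mu> + r))) = p * r / (\<mu> + r) - p / (\<mu> + 1)" for p
      proof -
        have "\<mu> + 1 \<noteq> 0" "\<mu> + r \<noteq> 0" using True l by auto
        then show ?thesis by (simp add: divide_simps) (simp add: algebra_simps)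
      qed
      note * = this[of "\<mu> powr (s - 1)"]
      have "h \<mu> = r powr (s - 1) * ((\<mu> / r) powr (s - 1) / (\<mu> / r + 1))"
        using True l by (simp add: h_def stieltjes_density_def)
      also have "\<dots> = \<mu> powr (s - 1) / (\<mu> / r + 1)" using True l by (simp add: powr_divide)
      also have "\<dots> = \<mu> powr (s - 1) * r / (\<mu> + r)" using l by (simp add: field_simps)
      finally show ?thesis using True * by (simp add: stieltjes_density_def)
    next
      case False
      then show ?thesis using l by (simp add: h_def stieltjes_density_def divide_simps)
    qed
    then have "(r - 1) * (LINT \<mu>|lborel. ?k \<mu> * (\<mu> / (\<mu> + r))) = (LINT \<mu>|lborel. h \<mu> - ?k \<mu>)"
      by (subst integral_mult_right_zero[symmetric]) simp
    also have "\<dots> = (r powr s - 1) * ?K"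
      by (subst Bochner_Integration.integral_diff[OF h_int int]) (simp add: h stieltjes_const_def left_diff_distrib)
    finally show ?thesis .
  qed
  then show ?thesis using K by (simp add: integral_stieltjes_measure[OF s] field_simps)
qed

lemma scaled_resolvent_charfun:
  fixes \<xi> :: "'a::euclidean_space"
  assumes "\<mu> > 0"
  shows "(LINT z|resolvent_measure. exp (- (\<i> * of_real (((1 / sqrt \<mu>) *\<^sub>R z) \<bullet> \<xi>)))) = of_real (\<mu> / (\<mu> + (norm \<xi>)\<^sup>2))"
proof -
  have "(LINT z|resolvent_measure. exp (- (\<i> * of_real (((1 / sqrt \<mu>) *\<^sub>R z) \<bullet> \<xi>)))) =
      (LINT z|resolvent_measure. exp (- (\<i> * of_real (z \<bullet> ((1 / sqrt \<mu>) *\<^sub>R \<xi>)))))"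
    by simp
  also have "\<dots> = of_real (1 / (1 + (norm ((1 / sqrt \<mu>) *\<^sub>R \<xi>))\<^sup>2))" by (rule resolvent_measure_charfun)
  also have "1 / (1 + (norm ((1 / sqrt \<mu>) *\<^sub>R \<xi>))\<^sup>2) = \<mu> / (\<mu> + (norm \<xi>)\<^sup>2)"
    using assms by (simp add: power_mult_distrib power_divide field_simps)
  finally show ?thesis .
qed

text \<open>Averaging over the scaled resolvent kernel is \<open>\<mu> (\<mu> - \<Delta>)\<inverse>\<close>, and
  \<open>-\<Delta> (\<mu> - \<Delta>)\<inverse> = 1 - \<mu> (\<mu> - \<Delta>)\<inverse>\<close>.\<close>

lemma resolvent_laplacian:
  fixes f :: "'a::euclidean_space \<Rightarrow> complex"
  assumes f: "f \<in> schwartz" and mu: "\<mu> > 0"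
  shows "(LINT z|resolvent_measure. - laplacian f (x - (1 / sqrt \<mu>) *\<^sub>R z)) =
    of_real \<mu> * (f x - (LINT z|resolvent_measure. f (x - (1 / sqrt \<mu>) *\<^sub>R z)))"
proof -
  let ?Z = "\<lambda>z::'a. (1 / sqrt \<mu>) *\<^sub>R z"
  let ?m = "\<lambda>\<xi>::'a. complex_of_real (\<mu> / (\<mu> + (norm \<xi>)\<^sup>2))"
  have m_le: "norm (?m \<xi>) \<le> 1" for \<xi>
    unfolding norm_of_real using mu by (simp add: divide_le_eq abs_of_nonneg add_pos_nonneg)
  have Z: "?Z \<in> resolvent_measure \<rightarrow>\<^sub>M borel" by measurable
  have lap: "laplacian f \<in> schwartz" by (rule schwartz_laplacian[OF f])
  have avg: "(LINT z|resolvent_measure. g (x - ?Z z)) = inverse_fourier (\<lambda>\<xi>. ?m \<xi> * fourier g \<xi>) x"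
    if "g \<in> schwartz" for g
    using average_translates_fourier[OF that prob_space_resolvent Z, of x]
    by (simp only: scaled_resolvent_charfun[OF mu])
  have int: "integrable lborel (\<lambda>\<xi>. ?m \<xi> * fourier f \<xi>)"
    by (rule fourier_multiplier_integrable[OF f]) (measurable, rule order_trans[OF m_le], simp)
  have "(LINT z|resolvent_measure. - laplacian f (x - ?Z z)) = - inverse_fourier (\<lambda>\<xi>. ?m \<xi> * fourier (laplacian f) \<xi>) x"
    by (simp add: avg[OF lap])
  also have "\<dots> = inverse_fourier (\<lambda>\<xi>. (- 1) * (?m \<xi> * fourier (laplacian f) \<xi>)) x"
    by (subst inverse_fourier_cmult) simp
  also have "(\<lambda>\<xi>. (- 1) * (?m \<xi> * fourier (laplacian f) \<xi>)) = (\<lambda>\<xi>. of_real \<mu> * (fourier f \<xi> - ?m \<xi> * fourier f \<xi>))"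
  proof
    fix \<xi> :: 'a
    have eq: "of_real ((norm \<xi>)\<^sup>2) * ?m \<xi> = of_real \<mu> * (1 - ?m \<xi>)"
    proof -
      have "\<mu> + (norm \<xi>)\<^sup>2 \<noteq> 0" using mu by (simp add: add_pos_nonneg less_imp_neq[symmetric])
      then have "(norm \<xi>)\<^sup>2 * (\<mu> / (\<mu> + (norm \<xi>)\<^sup>2)) = \<mu> * (1 - \<mu> / (\<mu> + (norm \<xi>)\<^sup>2))"
        by (simp add: field_simps)
      then show ?thesis by (metis of_real_1 of_real_diff of_real_mult)
    qed
    have "(- 1) * (?m \<xi> * fourier (laplacian f) \<xi>) = (of_real ((norm \<xi>)\<^sup>2) * ?m \<xi>) * fourier f \<xi>"
      unfolding fourier_laplacian[OF f] by (simp only: minus_mult_minus mult_minus_left mult_minus_right mult_1 minus_minus mult_ac)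
    also have "\<dots> = of_real \<mu> * (fourier f \<xi> - ?m \<xi> * fourier f \<xi>)"
      by (simp only: eq left_diff_distrib right_diff_distrib mult.assoc mult_1_left mult_1_right)
    finally show "(- 1) * (?m \<xi> * fourier (laplacian f) \<xi>) = of_real \<mu> * (fourier f \<xi> - ?m \<xi> * fourier f \<xi>)" .
  qed
  also have "inverse_fourier \<dots> x = of_real \<mu> * (f x - (LINT z|resolvent_measure. f (x - ?Z z)))"
    by (simp only: inverse_fourier_cmult inverse_fourier_diff[OF fourier_integrable[OF f] int] avg[OF f] fourier_inversion[OF f])
  finally show ?thesis .
qed

text \<open>Both sides are inverse Fourier transforms: by \<open>average_translates_fourier\<close> the right-hand side has
  the multiplier \<open>(r - 1) \<integral> \<mu> / (\<mu> + r) d\<kappa>(\<mu>)\<close> with \<open>r = |\<xi>|\<^sup>2\<close>, and this is \<open>r\<^sup>s - 1\<close>.\<close>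

theorem frac_laplacian_average:
  fixes f :: "'a::euclidean_space \<Rightarrow> complex"
  assumes f: "f \<in> schwartz" and s: "0 < s" "s < 1"
  shows "frac_laplacian s f x - f x =
    (LINT p|(stieltjes_measure s \<Otimes>\<^sub>M resolvent_measure).
       (\<lambda>y. - laplacian f y - f y) (x - (1 / sqrt (fst p)) *\<^sub>R snd p))"
proof -
  let ?k = "stieltjes_measure s" and ?r = "resolvent_measure :: 'a measure"
  interpret K: prob_space ?k by (rule prob_space_stieltjes[OF s])
  interpret R: prob_space ?r by (rule prob_space_resolvent)
  interpret KR: pair_prob_space ?k ?r ..
  let ?Z = "\<lambda>p::real \<times> 'a. (1 / sqrt (fst p)) *\<^sub>R snd p"
  let ?g = "\<lambda>y. (-1) * laplacian f y + (-1) * f y"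
  have g: "?g \<in> schwartz" by (intro schwartz_add schwartz_cmult schwartz_laplacian f)
  have char: "(LINT p|(?k \<Otimes>\<^sub>M ?r). exp (- (\<i> * of_real (?Z p \<bullet> \<xi>)))) = of_real (LINT \<mu>|?k. \<mu> / (\<mu> + (norm \<xi>)\<^sup>2))" for \<xi>
  proof -
    have "(LINT p|(?k \<Otimes>\<^sub>M ?r). exp (- (\<i> * of_real (?Z p \<bullet> \<xi>)))) =
        (LINT \<mu>|?k. LINT z|?r. exp (- (\<i> * of_real (?Z (\<mu>, z) \<bullet> \<xi>))))"
      by (rule KR.integral_fst'[symmetric], rule KR.P.integrable_const_bound[of _ 1])
         (auto simp: norm_exp_minus_i)
    also have "\<dots> = (LINT \<mu>|?k. complex_of_real (\<mu> / (\<mu> + (norm \<xi>)\<^sup>2)))"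
      by (intro integral_cong_AE) (use stieltjes_measure_pos[of s] in \<open>auto elim!: eventually_mono simp: scaled_resolvent_charfun simp del: inner_scaleR_left\<close>)
    finally show ?thesis by (simp only: integral_complex_of_real)
  qed
  have mult: "of_real (LINT \<mu>|?k. \<mu> / (\<mu> + (norm \<xi>)\<^sup>2)) * fourier ?g \<xi> =
      of_real (norm \<xi> powr (2 * s)) * fourier f \<xi> - fourier f \<xi>" for \<xi>
  proof -
    have "fourier ?g \<xi> = of_real ((norm \<xi>)\<^sup>2 - 1) * fourier f \<xi>"
      unfolding fourier_add[OF schwartz_cmult[OF schwartz_laplacian[OF f]] schwartz_cmult[OF f]]
        fourier_cmult fourier_laplacian[OF f] by (simp add: algebra_simps)
    moreover have "((norm \<xi>)\<^sup>2 - 1) * (LINT \<mu>|?k. \<mu> / (\<mu> + (norm \<xi>)\<^sup>2)) = norm \<xi> powr (2 * s) - 1"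
    proof -
      have "norm \<xi> powr (2 * s) = ((norm \<xi>)\<^sup>2) powr s"
        by (cases "\<xi> = 0") (auto simp: powr_powr powr_numeral[symmetric] simp del: powr_numeral)
      then show ?thesis using stieltjes_representation[OF s, of "(norm \<xi>)\<^sup>2"] by simp
    qed
    ultimately have "of_real (LINT \<mu>|?k. \<mu> / (\<mu> + (norm \<xi>)\<^sup>2)) * fourier ?g \<xi> = of_real (norm \<xi> powr (2 * s) - 1) * fourier f \<xi>"
      by (metis mult.assoc mult.commute of_real_mult)
    then show ?thesis by (simp add: algebra_simps)
  qed
  have int: "integrable lborel (\<lambda>\<xi>. of_real (norm \<xi> powr (2 * s)) * fourier f \<xi>)"
  proof (rule fourier_multiplier_integrable[OF f])
    fix \<xi> :: 'a
    have "norm \<xi> powr (2 * s) \<le> 1 + (norm \<xi>)\<^sup>2"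
    proof (cases "norm \<xi> \<le> 1")
      case True
      then have "norm \<xi> powr (2 * s) \<le> 1" using s by (cases "\<xi> = 0") (auto intro: powr_le1)
      then show ?thesis by (simp add: add_increasing2)
    next
      case False
      then have "norm \<xi> powr (2 * s) \<le> norm \<xi> powr 2" using s by (intro powr_mono) auto
      also have "\<dots> = (norm \<xi>)\<^sup>2" using False by (simp add: powr_numeral)
      finally show ?thesis by simp
    qed
    then show "norm (complex_of_real (norm \<xi> powr (2 * s))) \<le> 1 + (norm \<xi>)\<^sup>2" by simp
  qed measurable
  have "(LINT p|(?k \<Otimes>\<^sub>M ?r). ?g (x - ?Z p)) =
      inverse_fourier (\<lambda>\<xi>. of_real (norm \<xi> powr (2 * s)) * fourier f \<xi> - fourier f \<xi>) x"
    by (subst average_translates_fourier[OF g KR.P.prob_space_axioms]) (auto simp only: char mult, measurable)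
  also have "\<dots> = frac_laplacian s f x - f x"
    by (simp only: inverse_fourier_diff[OF int fourier_integrable[OF f]] frac_laplacian_def fourier_inversion[OF f])
  finally show ?thesis by simp
qed

section \<open>A maximum principle for families of Markov operators\<close>

text \<open>Put \<open>D\<^sub>\<mu> = f - Q\<^sub>\<mu> f\<close>. The last two hypotheses say that \<open>f = \<integral> D\<^sub>\<mu> dK\<close> and \<open>\<integral> \<mu> D\<^sub>\<mu> dK = 0\<close>, hence
  \<open>f = \<integral> (1 - \<mu>/e) D\<^sub>\<mu> dK\<close> for every \<open>e > 0\<close>. At a point where \<open>f\<close> is within \<open>\<eta>\<close> of its supremum \<open>M\<close>,
  the Markov property gives \<open>D\<^sub>\<mu> \<ge> -\<eta>\<close>. For \<open>\<mu> > e\<close> the weight is negative, so that the integrand is,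
  because of \<open>\<bar>\<mu> D\<^sub>\<mu>\<bar> \<le> A\<close>, at most \<open>min (\<mu> \<eta>) A / e\<close>; for \<open>\<mu> \<le> e\<close> it is at most \<open>2 B\<close>. The part over \<open>(0, e]\<close> is made
  smaller than \<open>M\<close> by the choice of \<open>e\<close>, and the rest tends to 0 with \<open>\<eta>\<close>, so \<open>M > 0\<close> is impossible.\<close>

lemma averaged_markov_nonpos:
  fixes f :: "'a \<Rightarrow> real" and Q :: "real \<Rightarrow> 'a \<Rightarrow> real"
  assumes K: "prob_space K" and sets[measurable_cong]: "sets K = sets borel"
    and pos: "AE \<mu> in K. \<mu> > 0"
    and meas[measurable]: "\<And>y. (\<lambda>\<mu>. Q \<mu> y) \<in> borel_measurable borel"
    and markov: "\<And>\<mu> y M. (\<And>x. f x \<le> M) \<Longrightarrow> Q \<mu> y \<le> M"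
    and f_bdd: "\<And>y. \<bar>f y\<bar> \<le> B" and Q_bdd: "\<And>\<mu> y. \<bar>Q \<mu> y\<bar> \<le> B"
    and gen_bdd: "\<And>\<mu> y. \<mu> > 0 \<Longrightarrow> \<bar>\<mu> * (f y - Q \<mu> y)\<bar> \<le> A"
    and Q0: "\<And>y. (LINT \<mu>|K. Q \<mu> y) = 0"
    and gen0: "\<And>y. (LINT \<mu>|K. \<mu> * (f y - Q \<mu> y)) = 0"
  shows "f y \<le> 0"
proof (rule ccontr)
  assume "\<not> f y \<le> 0"
  interpret K: prob_space K by fact
  define M where "M = (SUP x. f x)"
  have bdd: "bdd_above (range f)" using f_bdd by (intro bdd_aboveI[of _ B]) (auto intro: order_trans[OF abs_ge_self])
  have le_M: "f x \<le> M" for x unfolding M_def using bdd by (intro cSUP_upper) auto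
  with \<open>\<not> f y \<le> 0\<close> have M: "M > 0" by (metis less_le_trans not_le)
  have B: "B \<ge> 0" using f_bdd[of y] by linarith
  have A: "A \<ge> 0" using gen_bdd[of 1 y] by linarith
  define X where "X n = 1 / real (Suc n)" for n
  have X: "X \<longlonglongrightarrow> 0" "\<And>n. X n > 0" unfolding X_def by (rule LIMSEQ_Suc[OF lim_1_over_n]) simp
  have "(\<lambda>n. LINT \<mu>|K. 2 * B * indicator {..X n} \<mu>) \<longlonglongrightarrow> (LINT \<mu>|K. 0)"
  proof (rule integral_dominated_convergence)
    show "AE \<mu> in K. (\<lambda>n. 2 * B * indicator {..X n} \<mu>) \<longlonglongrightarrow> 0"
      using pos
    proof eventually_elim
      fix \<mu> :: real assume "\<mu> > 0"
      with X have "\<forall>\<^sub>F n in sequentially. X n < \<mu>" by (intro order_tendstoD)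
      then have "\<forall>\<^sub>F n in sequentially. 2 * B * indicator {..X n} \<mu> = 0"
        by eventually_elim (auto simp: indicator_def)
      then show "(\<lambda>n. 2 * B * indicator {..X n} \<mu>) \<longlonglongrightarrow> 0" by (rule tendsto_eventually)
    qed
    show "AE \<mu> in K. norm (2 * B * indicator {..X n} \<mu>) \<le> 2 * B" for n
      using B by (auto simp: indicator_def)
  qed auto
  then have "\<forall>\<^sub>F n in sequentially. (LINT \<mu>|K. 2 * B * indicator {..X n} \<mu>) < M"
    using M by (intro order_tendstoD) auto
  then obtain n0 where n0: "(LINT \<mu>|K. 2 * B * indicator {..X n0} \<mu>) < M"
    by (auto simp: eventually_sequentially)
  define e where "e = X n0"
  have e: "e > 0" using X by (simp add: e_def)
  have min_bdd: "AE \<mu> in K. norm (min (\<mu> * X n) A / e) \<le> A / e" for n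
    using pos
  proof eventually_elim
    fix \<mu> :: real assume "\<mu> > 0"
    then have "0 \<le> \<mu> * X n" using X(2)[of n] by simp
    then show "norm (min (\<mu> * X n) A / e) \<le> A / e" using A e by (simp add: divide_right_mono)
  qed
  have small: "(\<lambda>n. LINT \<mu>|K. min (\<mu> * X n) A / e) \<longlonglongrightarrow> (LINT \<mu>|K. 0)"
  proof (rule integral_dominated_convergence)
    show "AE \<mu> in K. (\<lambda>n. min (\<mu> * X n) A / e) \<longlonglongrightarrow> 0"
    proof (rule AE_I2)
      fix \<mu>
      have "(\<lambda>n. min (\<mu> * X n) A / e) \<longlonglongrightarrow> min (\<mu> * 0) A / e"
        using e by (intro tendsto_intros X) auto
      then show "(\<lambda>n. min (\<mu> * X n) A / e) \<longlonglongrightarrow> 0" using A by simp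
    qed
  qed (use min_bdd in auto)
  have ineq: "M - X n \<le> (LINT \<mu>|K. 2 * B * indicator {..e} \<mu>) + (LINT \<mu>|K. min (\<mu> * X n) A / e)" for n
  proof -
    have "M - X n < (SUP x. f x)" using X(2)[of n] by (simp add: M_def)
    then obtain x where x: "M - X n < f x" using bdd by (subst (asm) less_cSUP_iff) auto
    have int1: "integrable K (\<lambda>\<mu>. f x - Q \<mu> x)"
    proof (rule K.integrable_const_bound[of _ "B + B"])
      have "\<bar>f x - Q \<mu> x\<bar> \<le> B + B" for \<mu> using f_bdd[of x] Q_bdd[of \<mu> x] by linarith
      then show "AE \<mu> in K. norm (f x - Q \<mu> x) \<le> B + B" by simp
    qed measurable
    have int2: "integrable K (\<lambda>\<mu>. \<mu> * (f x - Q \<mu> x))"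
      by (rule K.integrable_const_bound[of _ A]) (use pos gen_bdd in \<open>auto elim!: eventually_mono\<close>)
    have intQ: "integrable K (\<lambda>\<mu>. Q \<mu> x)"
      using Q_bdd[of _ x] by (intro K.integrable_const_bound[of _ B] AE_I2) auto
    have intm: "integrable K (\<lambda>\<mu>. min (\<mu> * X n) A / e)"
      by (rule K.integrable_const_bound[OF min_bdd]) measurable
    have inti: "integrable K (\<lambda>\<mu>. 2 * B * indicator {..e} \<mu>)"
      by (rule K.integrable_const_bound[of _ "2 * B"]) (use B in \<open>auto simp: indicator_def\<close>)
    have "f x = (LINT \<mu>|K. f x - Q \<mu> x)"
      using Q0[of x] intQ by (subst Bochner_Integration.integral_diff) (auto simp: K.prob_space)
    also have "\<dots> = (LINT \<mu>|K. (f x - Q \<mu> x) - (1 / e) * (\<mu> * (f x - Q \<mu> x)))"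
      using gen0[of x] int1 int2 by (subst Bochner_Integration.integral_diff) auto
    also have "\<dots> \<le> (LINT \<mu>|K. 2 * B * indicator {..e} \<mu> + min (\<mu> * X n) A / e)"
    proof (rule integral_mono_AE)
      show "AE \<mu> in K. (f x - Q \<mu> x) - (1 / e) * (\<mu> * (f x - Q \<mu> x)) \<le> 2 * B * indicator {..e} \<mu> + min (\<mu> * X n) A / e"
        using pos
      proof eventually_elim
        fix \<mu> :: real assume mu: "\<mu> > 0"
        define d where "d = f x - Q \<mu> x"
        have d_ge: "- d \<le> X n" using markov[OF le_M, of \<mu> x] x by (simp add: d_def)
        have d_le: "\<bar>d\<bar> \<le> 2 * B" using f_bdd[of x] Q_bdd[of \<mu> x] by (auto simp: d_def)
        have gen: "\<bar>\<mu> * d\<bar> \<le> A" using gen_bdd[OF mu, of x] by (simp add: d_def)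
        have min0: "min (\<mu> * X n) A / e \<ge> 0" using mu X(2)[of n] A e by simp
        have "d - (1 / e) * (\<mu> * d) = (1 - \<mu> / e) * d" by (simp add: algebra_simps)
        also have "\<dots> \<le> 2 * B * indicator {..e} \<mu> + min (\<mu> * X n) A / e"
        proof (cases "\<mu> \<le> e")
          case True
          have "(1 - \<mu> / e) * d \<le> (1 - \<mu> / e) * \<bar>d\<bar>" using True e by (intro mult_left_mono) auto
          also have "\<dots> \<le> 1 * \<bar>d\<bar>" using mu e by (intro mult_right_mono) auto
          finally show ?thesis using True d_le min0 by simp
        next
          case False
          have "(1 - \<mu> / e) * d \<le> min (\<mu> * X n) A / e"
          proof (cases "d \<ge> 0")
            case True
            have "1 - \<mu> / e \<le> 0" using False e by simp
            then have "(1 - \<mu> / e) * d \<le> 0" using True by (rule mult_nonpos_nonneg)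
            with min0 show ?thesis by linarith
          next
            case d_neg: False
            have "(1 - \<mu> / e) * d = d + \<mu> * (- d) / e" by (simp add: algebra_simps)
            also have "\<dots> \<le> \<mu> * (- d) / e" using d_neg by simp
            also have "\<dots> \<le> min (\<mu> * X n) A / e"
              using mult_left_mono[OF d_ge, of \<mu>] mu gen e by (intro divide_right_mono) auto
            finally show ?thesis .
          qed
          then show ?thesis using False by simp
        qed
        finally show "(f x - Q \<mu> x) - (1 / e) * (\<mu> * (f x - Q \<mu> x)) \<le> 2 * B * indicator {..e} \<mu> + min (\<mu> * X n) A / e"
          by (simp only: d_def)
      qed
    qed (use int1 int2 intm inti in auto)
    also have "\<dots> = (LINT \<mu>|K. 2 * B * indicator {..e} \<mu>) + (LINT \<mu>|K. min (\<mu> * X n) A / e)"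
      by (rule Bochner_Integration.integral_add[OF inti intm])
    finally show ?thesis using x by linarith
  qed
  have "(\<lambda>n. M - X n) \<longlonglongrightarrow> M - 0" by (intro tendsto_intros X)
  moreover have "(\<lambda>n. (LINT \<mu>|K. 2 * B * indicator {..e} \<mu>) + (LINT \<mu>|K. min (\<mu> * X n) A / e))
      \<longlonglongrightarrow> (LINT \<mu>|K. 2 * B * indicator {..e} \<mu>) + (LINT \<mu>|K. 0)"
    by (intro tendsto_intros small)
  ultimately have "M - 0 \<le> (LINT \<mu>|K. 2 * B * indicator {..e} \<mu>) + (LINT \<mu>|K. 0)"
    by (rule LIMSEQ_le) (use ineq in auto)
  with n0 show False by (simp add: e_def)
qed

section \<open>Equivalence of the two Helmholtz equations\<close>

text \<open>Up to a reflection of \<open>f\<close>, this is the convolution of \<open>u\<close> with \<open>f\<close>.\<close>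

definition translation_pairing :: "('a::euclidean_space \<Rightarrow> real) \<Rightarrow> ('a \<Rightarrow> complex) \<Rightarrow> 'a \<Rightarrow> complex"
  where "translation_pairing u f y = (LINT x|lborel. of_real (u x) * f (x - y))"

lemma schwartz_integral_norm_translate:
  assumes f: "f \<in> schwartz"
  shows "(LINT x|lborel. norm (f (x - y))) = (LINT x|lborel. norm (f x))"
proof -
  have [measurable]: "f \<in> borel_measurable borel" using f by (rule schwartz_measurable)
  have "complex_of_real (LINT x|lborel. norm (f (x - y))) = of_real (LINT x|lborel. norm (f x))"
    using lborel_integral_translate(2)[of "\<lambda>x. of_real (norm (f x))" "- y"]
    by (simp add: integral_complex_of_real[symmetric] del: integral_complex_of_real)
  then show ?thesis by (simp only: of_real_eq_iff)
qed

text \<open>Everywhere bounded Borel representatives make all integrands below jointly measurable, so that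
  Fubini's theorem applies.\<close>

locale bounded_borel =
  fixes u :: "'a::euclidean_space \<Rightarrow> real" and C :: real
  assumes u_measurable [measurable]: "u \<in> borel_measurable borel"
    and u_bounded: "\<bar>u x\<bar> \<le> C"
begin

lemma C_nonneg: "C \<ge> 0"
  using u_bounded[of 0] by linarith

lemma pairing_lborel:
  assumes "f \<in> borel_measurable borel"
  shows "pairing u f = (LINT x|lborel. of_real (u x) * f x)"
  unfolding pairing_def by (rule integral_completion) (use assms in measurable)

lemma pairing_integrand:
  fixes f :: "'a \<Rightarrow> complex"
  assumes "integrable lborel f"
  shows "integrable lborel (\<lambda>x. of_real (u x) * f x)"
  by (rule integrable_mult_bounded[of _ _ _ C]) (use assms u_bounded in auto)

lemma translation_pairing_eq_pairing:
  assumes "f \<in> schwartz"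
  shows "translation_pairing u f y = pairing u (\<lambda>x. f (x - y))"
proof -
  have [measurable]: "f \<in> borel_measurable borel" using assms by (rule schwartz_measurable)
  show ?thesis unfolding translation_pairing_def by (rule pairing_lborel[symmetric]) measurable
qed

lemma translation_pairing_measurable:
  assumes "f \<in> schwartz"
  shows "translation_pairing u f \<in> borel_measurable borel"
proof -
  have [measurable]: "f \<in> borel_measurable borel" using assms by (rule schwartz_measurable)
  show ?thesis unfolding translation_pairing_def[abs_def] by measurable
qed

lemma translation_pairing_bound:
  assumes f: "f \<in> schwartz"
  shows "\<exists>B\<ge>0. \<forall>y. norm (translation_pairing u f y) \<le> B"
proof (intro exI conjI allI)
  have [measurable]: "f \<in> borel_measurable borel" using f by (rule schwartz_measurable)
  let ?I = "LINT x|lborel. norm (f x)"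
  show "0 \<le> C * ?I" using C_nonneg by simp
  fix y
  have fy: "integrable lborel (\<lambda>x. f (x - y))"
    using schwartz_integrable[OF schwartz_shift[OF f, of "- y"]] by simp
  have "norm (translation_pairing u f y) \<le> (LINT x|lborel. norm (of_real (u x) * f (x - y)))"
    unfolding translation_pairing_def by (rule integral_norm_bound)
  also have "\<dots> \<le> (LINT x|lborel. C * norm (f (x - y)))"
    by (rule integral_mono)
       (use fy integrable_norm[OF pairing_integrand[OF fy]] u_bounded in \<open>auto simp: norm_mult intro!: mult_right_mono\<close>)
  also have "\<dots> = C * (LINT x|lborel. norm (f (x - y)))" by (rule integral_mult_right_zero)
  also have "(LINT x|lborel. norm (f (x - y))) = ?I"
    by (rule schwartz_integral_norm_translate[OF f])
  finally show "norm (translation_pairing u f y) \<le> C * ?I" .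
qed

lemma average_pairing:
  fixes Z :: "'w \<Rightarrow> 'a"
  assumes f: "f \<in> schwartz" and P: "prob_space P" and Z[measurable]: "Z \<in> P \<rightarrow>\<^sub>M borel"
  shows "integrable lborel (\<lambda>x. LINT w|P. f (x - Z w))"
    and "(LINT x|lborel. of_real (u x) * (LINT w|P. f (x - Z w))) = (LINT w|P. translation_pairing u f (Z w))"
proof -
  interpret P: prob_space P by fact
  interpret Q: pair_sigma_finite P lborel ..
  have [measurable]: "f \<in> borel_measurable borel" using f by (rule schwartz_measurable)
  have shift: "integrable lborel (\<lambda>x. f (x - y))" for y
    using schwartz_integrable[OF schwartz_shift[OF f, of "- y"]] by simp
  have int: "integrable (P \<Otimes>\<^sub>M lborel) (\<lambda>(w, x). f (x - Z w))"
  proof (rule Q.Fubini_integrable)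
    show "integrable P (\<lambda>w. LINT x|lborel. norm ((\<lambda>(w, x). f (x - Z w)) (w, x)))"
      by (simp add: schwartz_integral_norm_translate[OF f])
  qed (auto intro: shift)
  have "integrable (lborel \<Otimes>\<^sub>M P) (\<lambda>(x, w). f (x - Z w))"
    using Q.integrable_product_swap[OF int] by simp
  interpret Q': pair_sigma_finite lborel P ..
  show "integrable lborel (\<lambda>x. LINT w|P. f (x - Z w))"
    using Q'.integrable_fst'[OF \<open>integrable (lborel \<Otimes>\<^sub>M P) (\<lambda>(x, w). f (x - Z w))\<close>] by simp
  have "integrable (P \<Otimes>\<^sub>M lborel) (\<lambda>z. of_real (u (snd z)) * (\<lambda>(w, x). f (x - Z w)) z)"
    by (rule integrable_mult_bounded[OF int, of _ C]) (use u_bounded in auto)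
  then have int_u: "integrable (P \<Otimes>\<^sub>M lborel) (\<lambda>(w, x). of_real (u x) * f (x - Z w))"
    by (simp add: case_prod_beta')
  have "(LINT x|lborel. of_real (u x) * (LINT w|P. f (x - Z w))) = (LINT x|lborel. LINT w|P. of_real (u x) * f (x - Z w))"
    by simp
  also have "\<dots> = (LINT w|P. LINT x|lborel. of_real (u x) * f (x - Z w))"
    by (rule Q.Fubini_integral[OF int_u])
  finally show "(LINT x|lborel. of_real (u x) * (LINT w|P. f (x - Z w))) = (LINT w|P. translation_pairing u f (Z w))"
    by (simp add: translation_pairing_def)
qed

end

abbreviation helmholtz_residual :: "('a::euclidean_space \<Rightarrow> complex) \<Rightarrow> 'a \<Rightarrow> complex"
  where "helmholtz_residual f \<equiv> \<lambda>y. - laplacian f y - f y"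

lemma schwartz_uminus: "f \<in> schwartz \<Longrightarrow> (\<lambda>x. - f x) \<in> schwartz"
  using schwartz_cmult[of f "-1"] by simp

lemma schwartz_diff: "f \<in> schwartz \<Longrightarrow> g \<in> schwartz \<Longrightarrow> (\<lambda>x. f x - g x) \<in> schwartz"
  using schwartz_add[OF _ schwartz_uminus, of f g] by simp

lemma schwartz_helmholtz_residual: "f \<in> schwartz \<Longrightarrow> helmholtz_residual f \<in> schwartz"
  by (intro schwartz_diff schwartz_uminus schwartz_laplacian)

lemma fourier_uminus: "fourier (\<lambda>x. - f x) \<xi> = - fourier f \<xi>"
  using fourier_cmult[of "-1" f] by simp

lemma fourier_helmholtz_residual:
  fixes f :: "'a::euclidean_space \<Rightarrow> complex"
  assumes f: "f \<in> schwartz"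
  shows "fourier (helmholtz_residual f) \<xi> = of_real ((norm \<xi>)\<^sup>2 - 1) * fourier f \<xi>"
proof -
  have "fourier (helmholtz_residual f) \<xi> = fourier (\<lambda>x. - laplacian f x) \<xi> + fourier (\<lambda>x. - f x) \<xi>"
    using fourier_add[OF schwartz_uminus[OF schwartz_laplacian[OF f]] schwartz_uminus[OF f]] by simp
  then show ?thesis by (simp add: fourier_uminus fourier_laplacian[OF f] algebra_simps)
qed

lemma schwartz_eqI_fourier:
  assumes "f \<in> schwartz" "g \<in> schwartz" "\<And>\<xi>. fourier f \<xi> = fourier g \<xi>"
  shows "f = g"
proof
  fix x
  from assms(3) have "fourier f = fourier g" by (rule ext)
  then show "f x = g x" by (metis assms(1,2) fourier_inversion)
qed

text \<open>Both sides have the transform \<open>|\<xi>|\<^sup>2 (|\<xi>|\<^sup>2 - 1)\<close> times that of \<open>f\<close>.\<close>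

lemma helmholtz_residual_uminus_laplacian:
  assumes f: "f \<in> schwartz"
  shows "helmholtz_residual (\<lambda>x. - laplacian f x) = (\<lambda>y. - laplacian (helmholtz_residual f) y)"
proof (rule schwartz_eqI_fourier)
  show "helmholtz_residual (\<lambda>x. - laplacian f x) \<in> schwartz"
    by (intro schwartz_helmholtz_residual schwartz_uminus schwartz_laplacian f)
  show "(\<lambda>y. - laplacian (helmholtz_residual f) y) \<in> schwartz"
    by (intro schwartz_helmholtz_residual schwartz_uminus schwartz_laplacian f)
  fix \<xi>
  show "fourier (helmholtz_residual (\<lambda>x. - laplacian f x)) \<xi> = fourier (\<lambda>y. - laplacian (helmholtz_residual f) y) \<xi>"
    unfolding fourier_helmholtz_residual[OF schwartz_uminus[OF schwartz_laplacian[OF f]]] fourier_uminus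
      fourier_laplacian[OF f] fourier_laplacian[OF schwartz_helmholtz_residual[OF f]] fourier_helmholtz_residual[OF f]
    by (simp add: mult_ac)
qed

context bounded_borel
begin

lemma pairing_diff:
  assumes f: "integrable lborel f" and g: "integrable lborel g"
  shows "pairing u (\<lambda>x. f x - g x) = pairing u f - pairing u g"
proof -
  have "f \<in> borel_measurable borel" "g \<in> borel_measurable borel" using f g by auto
  then show ?thesis
    using pairing_integrand[OF f] pairing_integrand[OF g]
    by (simp add: pairing_lborel right_diff_distrib)
qed

lemma helmholtz_iff:
  "helmholtz u \<longleftrightarrow> (\<forall>f\<in>schwartz. pairing u (helmholtz_residual f) = 0)"
proof -
  have "pairing u (helmholtz_residual f) = - distributional_laplacian u f - pairing u f" if f: "f \<in> schwartz" for f
  proof -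
    have "pairing u (helmholtz_residual f) = pairing u (\<lambda>x. - laplacian f x) - pairing u f"
      by (intro pairing_diff schwartz_integrable schwartz_uminus schwartz_laplacian f)
    also have "pairing u (\<lambda>x. - laplacian f x) = - distributional_laplacian u f"
      by (simp add: pairing_def distributional_laplacian_def)
    finally show ?thesis .
  qed
  then show ?thesis unfolding helmholtz_def by auto
qed

lemma
  assumes f: "f \<in> schwartz" and s: "0 < s" "s < 1"
  shows frac_laplacian_integrable: "integrable lborel (frac_laplacian s f)"
    and frac_pairing_average: "distributional_frac_laplacian s u f - pairing u f =
      (LINT p|(stieltjes_measure s \<Otimes>\<^sub>M resolvent_measure).
         translation_pairing u (helmholtz_residual f) ((1 / sqrt (fst p)) *\<^sub>R snd p))"
proof -
  interpret K: prob_space "stieltjes_measure s" by (rule prob_space_stieltjes[OF s])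
  interpret R: prob_space "resolvent_measure :: 'a measure" by (rule prob_space_resolvent)
  interpret KR: pair_prob_space "stieltjes_measure s" "resolvent_measure :: 'a measure" ..
  let ?P = "stieltjes_measure s \<Otimes>\<^sub>M (resolvent_measure :: 'a measure)"
  let ?Z = "\<lambda>p::real \<times> 'a. (1 / sqrt (fst p)) *\<^sub>R snd p"
  let ?h = "\<lambda>x. LINT p|?P. helmholtz_residual f (x - ?Z p)"
  have Z: "?Z \<in> ?P \<rightarrow>\<^sub>M borel" by measurable
  note avg = average_pairing[OF schwartz_helmholtz_residual[OF f] KR.P.prob_space_axioms Z]
  have h: "?h x = frac_laplacian s f x - f x" for x
    by (rule frac_laplacian_average[OF f s, symmetric])
  have "integrable lborel (\<lambda>x. ?h x + f x)"
    by (intro Bochner_Integration.integrable_add avg(1) schwartz_integrable f)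
  then show int: "integrable lborel (frac_laplacian s f)" by (simp only: h diff_add_cancel)
  have [measurable]: "frac_laplacian s f \<in> borel_measurable borel" "f \<in> borel_measurable borel"
    using int schwartz_measurable[OF f] by auto
  have "distributional_frac_laplacian s u f - pairing u f = pairing u (\<lambda>x. frac_laplacian s f x - f x)"
    unfolding distributional_frac_laplacian_def
    by (intro pairing_diff[symmetric] int schwartz_integrable f)
  also have "\<dots> = (LINT x|lborel. of_real (u x) * ?h x)"
    unfolding h by (rule pairing_lborel) measurable
  also have "\<dots> = (LINT p|?P. translation_pairing u (helmholtz_residual f) (?Z p))"
    by (rule avg(2))
  finally show "distributional_frac_laplacian s u f - pairing u f =
      (LINT p|?P. translation_pairing u (helmholtz_residual f) (?Z p))" .
qed

lemma helmholtz_imp_translation_pairing_zero: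
  assumes H: "helmholtz u" and f: "f \<in> schwartz"
  shows "translation_pairing u (helmholtz_residual f) y = 0"
proof -
  have "pairing u (helmholtz_residual (\<lambda>x. f (x - y))) = 0"
    using H schwartz_shift[OF f, of "- y"] unfolding helmholtz_iff by simp
  then show ?thesis
    using laplacian_shift[of f "- y"]
    by (simp add: translation_pairing_eq_pairing schwartz_helmholtz_residual f)
qed

text \<open>The average in \<open>frac_pairing_average\<close> is an average of zeros.\<close>

lemma helmholtz_imp_frac_helmholtz:
  assumes s: "0 < s" "s < 1" and H: "helmholtz u"
  shows "frac_helmholtz s u"
  unfolding frac_helmholtz_def
  using frac_pairing_average[OF _ s] helmholtz_imp_translation_pairing_zero[OF H] by simp

text \<open>The fractional equation tested with the translate of \<open>f\<close> by \<open>y\<close>.\<close>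

lemma frac_helmholtz_imp_average_zero:
  assumes s: "0 < s" "s < 1" and H: "frac_helmholtz s u" and f: "f \<in> schwartz"
  shows "(LINT \<mu>|stieltjes_measure s. LINT z|resolvent_measure.
      translation_pairing u (helmholtz_residual f) (y + (1 / sqrt \<mu>) *\<^sub>R z)) = 0"
proof -
  interpret K: prob_space "stieltjes_measure s" by (rule prob_space_stieltjes[OF s])
  interpret R: prob_space "resolvent_measure :: 'a measure" by (rule prob_space_resolvent)
  interpret KR: pair_prob_space "stieltjes_measure s" "resolvent_measure :: 'a measure" ..
  let ?P = "stieltjes_measure s \<Otimes>\<^sub>M (resolvent_measure :: 'a measure)"
  let ?V = "translation_pairing u (helmholtz_residual f)"
  have [measurable]: "?V \<in> borel_measurable borel"
    by (intro translation_pairing_measurable schwartz_helmholtz_residual f)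
  obtain B where B: "\<And>y. norm (?V y) \<le> B"
    using translation_pairing_bound[OF schwartz_helmholtz_residual[OF f]] by metis
  have fy: "(\<lambda>x. f (x - y)) \<in> schwartz" using schwartz_shift[OF f, of "- y"] by simp
  have res: "helmholtz_residual (\<lambda>x. f (x - y)) = (\<lambda>x. helmholtz_residual f (x - y))"
    using laplacian_shift[of f "- y"] by simp
  have "translation_pairing u (helmholtz_residual (\<lambda>x. f (x - y))) w = ?V (y + w)" for w
    unfolding res translation_pairing_def by (simp add: algebra_simps)
  then have "0 = (LINT p|?P. ?V (y + (1 / sqrt (fst p)) *\<^sub>R snd p))"
    using frac_pairing_average[OF fy s] H fy unfolding frac_helmholtz_def by simp
  also have "\<dots> = (LINT \<mu>|stieltjes_measure s. LINT z|resolvent_measure. ?V (y + (1 / sqrt \<mu>) *\<^sub>R z))"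
    by (subst KR.integral_fst'[symmetric]) (use B in \<open>auto intro!: KR.P.integrable_const_bound[of _ B]\<close>)
  finally show ?thesis by simp
qed

text \<open>\<open>resolvent_laplacian\<close> paired with \<open>u\<close>: this identifies the average obtained from the test function
  \<open>-\<Delta>f\<close> with \<open>\<mu> (V - Q\<^sub>\<mu> V)\<close>.\<close>

lemma resolvent_translation_pairing:
  assumes f: "f \<in> schwartz" and mu: "\<mu> > 0"
  shows "(LINT z|resolvent_measure. translation_pairing u (\<lambda>x. - laplacian f x) (y + (1 / sqrt \<mu>) *\<^sub>R z)) =
    of_real \<mu> * (translation_pairing u f y - (LINT z|resolvent_measure. translation_pairing u f (y + (1 / sqrt \<mu>) *\<^sub>R z)))"
proof -
  let ?Z = "\<lambda>z::'a. y + (1 / sqrt \<mu>) *\<^sub>R z"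
  have Z: "?Z \<in> resolvent_measure \<rightarrow>\<^sub>M borel" by measurable
  have lap: "(\<lambda>x. - laplacian f x) \<in> schwartz" by (intro schwartz_uminus schwartz_laplacian f)
  have fy: "integrable lborel (\<lambda>x. f (x - y))"
    using schwartz_integrable[OF schwartz_shift[OF f, of "- y"]] by simp
  note avg = average_pairing[OF _ prob_space_resolvent Z]
  have "(LINT z|resolvent_measure. translation_pairing u (\<lambda>x. - laplacian f x) (?Z z)) =
      (LINT x|lborel. of_real (u x) * (LINT z|resolvent_measure. - laplacian f (x - ?Z z)))"
    by (rule avg(2)[OF lap, symmetric])
  also have "\<dots> = (LINT x|lborel. of_real \<mu> * (of_real (u x) * f (x - y) -
      of_real (u x) * (LINT z|resolvent_measure. f (x - ?Z z))))"
  proof (intro Bochner_Integration.integral_cong refl)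
    fix x
    have "(LINT z|resolvent_measure. - laplacian f (x - ?Z z)) =
        of_real \<mu> * (f (x - y) - (LINT z|resolvent_measure. f (x - ?Z z)))"
      using resolvent_laplacian[OF f mu, of "x - y"] by (simp only: diff_diff_eq)
    then show "of_real (u x) * (LINT z|resolvent_measure. - laplacian f (x - ?Z z)) =
        of_real \<mu> * (of_real (u x) * f (x - y) - of_real (u x) * (LINT z|resolvent_measure. f (x - ?Z z)))"
      by (simp only: right_diff_distrib mult_ac)
  qed
  also have "\<dots> = of_real \<mu> * (LINT x|lborel. of_real (u x) * f (x - y) -
      of_real (u x) * (LINT z|resolvent_measure. f (x - ?Z z)))"
    by (rule integral_mult_right_zero)
  also have "(LINT x|lborel. of_real (u x) * f (x - y) -
      of_real (u x) * (LINT z|resolvent_measure. f (x - ?Z z))) =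
      translation_pairing u f y - (LINT z|resolvent_measure. translation_pairing u f (?Z z))"
    by (subst Bochner_Integration.integral_diff)
       (auto intro!: pairing_integrand fy avg(1)[OF f] simp: avg(2)[OF f] translation_pairing_def[of u f y])
  finally show ?thesis .
qed

lemma frac_helmholtz_imp_helmholtz:
  assumes s: "0 < s" "s < 1" and H: "frac_helmholtz s u"
  shows "helmholtz u"
  unfolding helmholtz_iff
proof
  fix f :: "'a \<Rightarrow> complex" assume f: "f \<in> schwartz"
  interpret K: prob_space "stieltjes_measure s" by (rule prob_space_stieltjes[OF s])
  interpret R: prob_space "resolvent_measure :: 'a measure" by (rule prob_space_resolvent)
  let ?K = "stieltjes_measure s" and ?R = "resolvent_measure :: 'a measure"
  let ?g = "helmholtz_residual f"
  have g: "?g \<in> schwartz" by (rule schwartz_helmholtz_residual[OF f])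
  have lap: "(\<lambda>x. - laplacian f x) \<in> schwartz" by (intro schwartz_uminus schwartz_laplacian f)
  have lapg: "(\<lambda>x. - laplacian ?g x) \<in> schwartz" by (intro schwartz_uminus schwartz_laplacian g)
  define V where "V = translation_pairing u ?g"
  define W where "W = translation_pairing u (\<lambda>x. - laplacian ?g x)"
  define Q where "Q \<mu> y = (LINT z|?R. V (y + (1 / sqrt \<mu>) *\<^sub>R z))" for \<mu> y
  have [measurable]: "V \<in> borel_measurable borel" "W \<in> borel_measurable borel"
    unfolding V_def W_def by (intro translation_pairing_measurable g lapg)+
  have Q_meas[measurable]: "(\<lambda>\<mu>. Q \<mu> y) \<in> borel_measurable borel" for y
    unfolding Q_def by measurable
  obtain B where B0: "B \<ge> 0" and B: "\<And>y. norm (V y) \<le> B" using translation_pairing_bound[OF g] unfolding V_def by metis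
  obtain A where A0: "A \<ge> 0" and A: "\<And>y. norm (W y) \<le> A" using translation_pairing_bound[OF lapg] unfolding W_def by metis
  have V_int: "integrable ?R (\<lambda>z. V (y + r *\<^sub>R z))" for y r
    by (rule R.integrable_const_bound[of _ B]) (use B in auto)
  have norm_avg: "norm (LINT z|?R. F (y + r *\<^sub>R z)) \<le> D" if "\<And>y. norm (F y) \<le> D" "D \<ge> 0" for F :: "'a \<Rightarrow> complex" and D y r
  proof -
    have "norm (LINT z|?R. F (y + r *\<^sub>R z)) \<le> (LINT z|?R. norm (F (y + r *\<^sub>R z)))"
      by (rule integral_norm_bound)
    also have "\<dots> \<le> (LINT z|?R. D)" by (rule integral_mono') (use that in auto)
    also have "\<dots> = D" using R.prob_space by simp
    finally show ?thesis .
  qed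
  have Q_bdd: "norm (Q \<mu> y) \<le> B" for \<mu> y
    unfolding Q_def by (rule norm_avg[OF B B0])
  have Q0: "(LINT \<mu>|?K. Q \<mu> y) = 0" for y
    unfolding Q_def V_def by (rule frac_helmholtz_imp_average_zero[OF s H f])
  have gen: "of_real \<mu> * (V y - Q \<mu> y) = (LINT z|?R. W (y + (1 / sqrt \<mu>) *\<^sub>R z))" if "\<mu> > 0" for \<mu> y
    unfolding V_def W_def Q_def by (rule resolvent_translation_pairing[OF g that, symmetric])
  have gen_bdd: "norm (of_real \<mu> * (V y - Q \<mu> y)) \<le> A" if "\<mu> > 0" for \<mu> y
    unfolding gen[OF that] by (rule norm_avg[OF A A0])
  have gen0: "(LINT \<mu>|?K. of_real \<mu> * (V y - Q \<mu> y)) = 0" for y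
  proof -
    have "(LINT \<mu>|?K. of_real \<mu> * (V y - Q \<mu> y)) = (LINT \<mu>|?K. LINT z|?R. W (y + (1 / sqrt \<mu>) *\<^sub>R z))"
      by (rule integral_cong_AE) (use stieltjes_measure_pos[of s] gen in \<open>auto elim!: eventually_mono\<close>)
    also have "\<dots> = 0"
      using frac_helmholtz_imp_average_zero[OF s H lap, of y]
      unfolding helmholtz_residual_uminus_laplacian[OF f] W_def .
    finally show ?thesis .
  qed
  \<comment> \<open>With \<open>c = 1, -1, \<i>, -\<i>\<close> the maximum principle bounds the real and imaginary parts of \<open>V\<close> from
    both sides.\<close>
  have "Re (c * V y) \<le> 0" if c: "norm c = 1" for c y
  proof (rule averaged_markov_nonpos[where K="?K" and Q="\<lambda>\<mu> y. Re (c * Q \<mu> y)" and B=B and A=A and f="\<lambda>y. Re (c * V y)"])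
    show "prob_space ?K" by (rule K.prob_space_axioms)
    show "AE \<mu> in ?K. \<mu> > 0" by (rule stieltjes_measure_pos)
    have Re_le: "\<bar>Re (c * z)\<bar> \<le> norm z" for z
      using abs_Re_le_cmod[of "c * z"] c by (simp add: norm_mult)
    show "\<bar>Re (c * V y)\<bar> \<le> B" for y by (rule order_trans[OF Re_le B])
    show "\<bar>Re (c * Q \<mu> y)\<bar> \<le> B" for \<mu> y by (rule order_trans[OF Re_le Q_bdd])
    have eq: "\<mu> * (Re (c * V y) - Re (c * Q \<mu> y)) = Re (c * (of_real \<mu> * (V y - Q \<mu> y)))" for \<mu> y
      by (simp add: algebra_simps)
    show "\<bar>\<mu> * (Re (c * V y) - Re (c * Q \<mu> y))\<bar> \<le> A" if "\<mu> > 0" for \<mu> y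
      unfolding eq by (rule order_trans[OF Re_le gen_bdd[OF that]])
    have Re_int: "(LINT \<mu>|?K. Re (c * F \<mu>)) = 0"
      if "(LINT \<mu>|?K. F \<mu>) = 0" "integrable ?K F" for F
    proof -
      have "(LINT \<mu>|?K. Re (c * F \<mu>)) = Re (LINT \<mu>|?K. c * F \<mu>)"
        by (rule integral_Re) (use that in simp)
      then show ?thesis using that by simp
    qed
    show "(LINT \<mu>|?K. Re (c * Q \<mu> y)) = 0" for y
      by (rule Re_int[OF Q0]) (rule K.integrable_const_bound[of _ B], use Q_bdd in auto)
    show "(LINT \<mu>|?K. \<mu> * (Re (c * V y) - Re (c * Q \<mu> y))) = 0" for y
      unfolding eq
      by (rule Re_int[OF gen0]) (rule K.integrable_const_bound[of _ A], use stieltjes_measure_pos[of s] gen_bdd in \<open>auto elim!: eventually_mono\<close>)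
    show "Re (c * Q \<mu> y) \<le> M" if M: "\<And>x. Re (c * V x) \<le> M" for \<mu> y M
    proof -
      have "Re (c * Q \<mu> y) = (LINT z|?R. Re (c * V (y + (1 / sqrt \<mu>) *\<^sub>R z)))"
        unfolding Q_def using V_int[of y "1 / sqrt \<mu>"]
        by (subst integral_mult_right_zero[symmetric], subst integral_Re) auto
      also have "\<dots> \<le> (LINT z|?R. M)"
        using V_int[of y "1 / sqrt \<mu>"] M by (intro integral_mono) auto
      also have "\<dots> = M" using R.prob_space by simp
      finally show ?thesis .
    qed
  qed (auto)
  from this[of 1 0] this[of "-1" 0] this[of "\<i>" 0] this[of "-\<i>" 0]
  have "V 0 = 0" by (simp add: complex_eq_iff)
  then show "pairing u ?g = 0"
    using translation_pairing_eq_pairing[OF g, of 0] by (simp add: V_def)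
qed

end

section \<open>Bounded solutions on the line\<close>

text \<open>From \<open>(t/m)\<^sup>m \<le> (1 + t/m)\<^sup>m \<le> exp t\<close> with \<open>t = a x\<^sup>2\<close>.\<close>

lemma power_mult_gaussian_bounded:
  fixes a :: real
  assumes a: "a > 0"
  shows "\<exists>B. \<forall>x::real. \<bar>x\<bar> ^ k * exp (- a * x\<^sup>2) \<le> B"
proof -
  \<comment> \<open>The successor keeps the denominator \<open>m\<close> away from 0.\<close>
  let ?m = "Suc k"
  have "\<bar>x\<bar> ^ k * exp (- a * x\<^sup>2) \<le> 1 + (real ?m / a) ^ ?m" for x :: real
  proof -
    have "(a * x\<^sup>2 / real ?m) ^ ?m \<le> (1 + a * x\<^sup>2 / real ?m) ^ ?m"
      using a by (intro power_mono) auto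
    also have "\<dots> \<le> exp (a * x\<^sup>2)"
      using a exp_ge_one_plus_x_over_n_power_n[of ?m "a * x\<^sup>2"] by (simp add: order_trans[of _ 0])
    finally have "(real ?m / a) ^ ?m * (a * x\<^sup>2 / real ?m) ^ ?m \<le> (real ?m / a) ^ ?m * exp (a * x\<^sup>2)"
      using a by (intro mult_left_mono) auto
    also have "(real ?m / a) ^ ?m * (a * x\<^sup>2 / real ?m) ^ ?m = (x\<^sup>2) ^ ?m"
      using a by (subst power_mult_distrib[symmetric]) (simp del: of_nat_Suc)
    finally have "(x\<^sup>2) ^ ?m * exp (- a * x\<^sup>2) \<le> (real ?m / a) ^ ?m * exp (a * x\<^sup>2) * exp (- a * x\<^sup>2)"
      by (intro mult_right_mono) auto
    also have "\<dots> = (real ?m / a) ^ ?m" by (simp add: exp_minus del: of_nat_Suc)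
    finally have le: "(x\<^sup>2) ^ ?m * exp (- a * x\<^sup>2) \<le> (real ?m / a) ^ ?m" .
    have "\<bar>x\<bar> ^ k \<le> 1 + (x\<^sup>2) ^ ?m"
    proof (cases "\<bar>x\<bar> \<le> 1")
      case True
      then have "\<bar>x\<bar> ^ k \<le> 1" by (simp add: power_le_one)
      then show ?thesis by (simp add: add_increasing2)
    next
      case False
      then have "\<bar>x\<bar> ^ k \<le> \<bar>x\<bar> ^ (2 * ?m)" by (intro power_increasing) auto
      also have "\<dots> = (x\<^sup>2) ^ ?m" by (subst power_mult) simp
      finally show ?thesis by simp
    qed
    then have "\<bar>x\<bar> ^ k * exp (- a * x\<^sup>2) \<le> (1 + (x\<^sup>2) ^ ?m) * exp (- a * x\<^sup>2)"
      by (intro mult_right_mono) auto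
    also have "\<dots> = exp (- a * x\<^sup>2) + (x\<^sup>2) ^ ?m * exp (- a * x\<^sup>2)" by (simp add: algebra_simps)
    also have "\<dots> \<le> 1 + (real ?m / a) ^ ?m" using a le by (intro add_mono) auto
    finally show ?thesis .
  qed
  then show ?thesis by blast
qed

text \<open>The class of functions \<open>p(x) exp (-a x\<^sup>2)\<close> with a polynomial \<open>p\<close> is closed under
  differentiation.\<close>

lemma gaussian_schwartz:
  fixes a :: real
  assumes a: "a > 0"
  shows "(\<lambda>x::real. complex_of_real (exp (- a * x\<^sup>2))) \<in> schwartz"
proof -
  define G where "G p x = complex_of_real (poly p x * exp (- a * x\<^sup>2))" for p and x :: real
  have "range G \<subseteq> schwartz"
  proof (rule schwartz_coinduct; clarify)
    fix p :: "real poly" and x :: real and k :: nat and b :: real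
    have deriv: "(G p has_derivative (\<lambda>h. h *\<^sub>R G (pderiv p - [:0, 2 * a:] * p) x)) (at x)" for x
    proof -
      have "((\<lambda>x. poly p x * exp (- a * x\<^sup>2)) has_real_derivative
          (poly (pderiv p - [:0, 2 * a:] * p) x * exp (- a * x\<^sup>2))) (at x)"
        by (auto intro!: derivative_eq_intros poly_DERIV) (simp add: algebra_simps power2_eq_square)
      then have "((\<lambda>x. complex_of_real (poly p x * exp (- a * x\<^sup>2))) has_vector_derivative
          complex_of_real (poly (pderiv p - [:0, 2 * a:] * p) x * exp (- a * x\<^sup>2))) (at x)"
        by (rule has_vector_derivative_of_real)
      then show ?thesis unfolding has_vector_derivative_def G_def .
    qed
    then show "G p differentiable (at x)" by (auto simp: differentiable_def)
    have "\<exists>B. \<forall>x. \<bar>x\<bar> ^ (k + i) * exp (- a * x\<^sup>2) \<le> B" for i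
      by (rule power_mult_gaussian_bounded[OF a])
    then obtain B where B: "\<And>i x. \<bar>x\<bar> ^ (k + i) * exp (- a * x\<^sup>2) \<le> B i" by metis
    have "norm x ^ k * norm (G p x) \<le> (\<Sum>i\<le>degree p. \<bar>coeff p i\<bar> * B i)" for x
    proof -
      have "norm x ^ k * norm (G p x) = \<bar>x\<bar> ^ k * (\<bar>\<Sum>i\<le>degree p. coeff p i * x ^ i\<bar> * exp (- a * x\<^sup>2))"
        unfolding G_def norm_of_real by (simp add: poly_altdef abs_mult)
      also have "\<dots> \<le> \<bar>x\<bar> ^ k * ((\<Sum>i\<le>degree p. \<bar>coeff p i * x ^ i\<bar>) * exp (- a * x\<^sup>2))"
        by (intro mult_left_mono mult_right_mono sum_abs) auto
      also have "\<dots> = (\<Sum>i\<le>degree p. \<bar>coeff p i\<bar> * (\<bar>x\<bar> ^ (k + i) * exp (- a * x\<^sup>2)))"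
        by (simp add: sum_distrib_left sum_distrib_right abs_mult power_abs power_add mult_ac)
      also have "\<dots> \<le> (\<Sum>i\<le>degree p. \<bar>coeff p i\<bar> * B i)"
        by (intro sum_mono mult_left_mono B) auto
      finally show ?thesis .
    qed
    then show "\<exists>B. \<forall>x. norm x ^ k * norm (G p x) \<le> B" by blast
    assume "b \<in> (Basis :: real set)"
    then have "partial_deriv b (G p) x = G (pderiv p - [:0, 2 * a:] * p) x" for x
      using fun_cong[OF frechet_derivative_at[OF deriv[of x]], of 1] by (simp add: partial_deriv_def)
    then show "partial_deriv b (G p) \<in> range G" by (auto simp: fun_eq_iff)
  qed
  moreover have "G 1 = (\<lambda>x. complex_of_real (exp (- a * x\<^sup>2)))" by (simp add: G_def fun_eq_iff)
  ultimately show ?thesis by (metis rangeI subsetD)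
qed

text \<open>The coefficients are recovered from \<open>w cos - w' sin\<close> and \<open>w sin + w' cos\<close>, which are conserved.\<close>

lemma harmonic_oscillator_solution:
  fixes w w' :: "real \<Rightarrow> real"
  assumes w: "\<And>x. (w has_real_derivative w' x) (at x)"
    and w': "\<And>x. (w' has_real_derivative - w x) (at x)"
  shows "w x = w 0 * cos x + w' 0 * sin x"
proof -
  have "((\<lambda>x. w x * cos x - w' x * sin x) has_real_derivative 0) (at x)" for x
    by (auto intro!: derivative_eq_intros w w')
  then have "w x * cos x - w' x * sin x = w 0 * cos 0 - w' 0 * sin 0"
    using DERIV_isconst_all by blast
  then have 1: "w x * cos x - w' x * sin x = w 0" by simp
  have "((\<lambda>x. w x * sin x + w' x * cos x) has_real_derivative 0) (at x)" for x
    by (auto intro!: derivative_eq_intros w w')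
  then have "w x * sin x + w' x * cos x = w 0 * sin 0 + w' 0 * cos 0"
    using DERIV_isconst_all by blast
  then have 2: "w x * sin x + w' x * cos x = w' 0" by simp
  have "w 0 * cos x + w' 0 * sin x =
      (w x * cos x - w' x * sin x) * cos x + (w x * sin x + w' x * cos x) * sin x"
    by (simp only: 1 2)
  also have "\<dots> = w x * ((sin x)\<^sup>2 + (cos x)\<^sup>2)" by algebra
  finally show ?thesis by simp
qed

lemma translation_pairing_derivative:
  fixes u :: "real \<Rightarrow> real"
  assumes "bounded_borel u C" and f: "f \<in> schwartz"
  shows "(translation_pairing u f has_vector_derivative - translation_pairing u (partial_deriv 1 f) y) (at y)"
proof -
  interpret bounded_borel u C by fact
  let ?g = "\<lambda>x. f (x + - y)"
  have "((\<lambda>h. LINT x|lborel. complex_of_real (u x) * ?g (x + h *\<^sub>R 1)) has_vector_derivative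
      (LINT x|lborel. of_real (u x) * partial_deriv 1 ?g x)) (at (y - y))"
    using has_vector_derivative_integral_schwartz[OF schwartz_shift[OF f, of "- y"], of 1 "\<lambda>x. complex_of_real (u x)" C] u_bounded
    by simp
  moreover have "((\<lambda>t. y - t) has_vector_derivative - 1) (at y)"
    by (auto intro!: derivative_eq_intros)
  ultimately have "((\<lambda>h. LINT x|lborel. complex_of_real (u x) * ?g (x + h *\<^sub>R 1)) \<circ> (\<lambda>t. y - t) has_vector_derivative
      (- 1) *\<^sub>R (LINT x|lborel. of_real (u x) * partial_deriv 1 ?g x)) (at y)"
    by (intro vector_diff_chain_at)
  moreover have "(\<lambda>h. LINT x|lborel. complex_of_real (u x) * ?g (x + h *\<^sub>R 1)) \<circ> (\<lambda>t. y - t) = translation_pairing u f"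
    by (simp add: translation_pairing_def comp_def fun_eq_iff algebra_simps)
  moreover have "(LINT x|lborel. of_real (u x) * partial_deriv 1 ?g x) = translation_pairing u (partial_deriv 1 f) y"
    by (simp only: partial_deriv_shift translation_pairing_def) simp
  ultimately show ?thesis by simp
qed

text \<open>Differentiation in \<open>y\<close> falls on the test function, and the equation turns the second derivative of the
  pairing into its negative.\<close>

lemma helmholtz_translation_pairing_1D:
  fixes u :: "real \<Rightarrow> real"
  assumes u: "bounded_borel u C" and H: "helmholtz u" and f: "f \<in> schwartz"
  shows "\<exists>A B. \<forall>y. Re (translation_pairing u f y) = A * cos y + B * sin y"
proof -
  interpret bounded_borel u C by fact
  let ?T = "translation_pairing u"
  have f1: "partial_deriv 1 f \<in> schwartz" using f by (intro schwartz_partial_deriv) auto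
  have lap: "laplacian f = partial_deriv 1 (partial_deriv 1 f)"
    by (simp add: laplacian_def fun_eq_iff)
  have T: "?T (laplacian f) y = - ?T f y" for y
  proof -
    have int: "integrable lborel (\<lambda>x. of_real (u x) * g (x - y))" if "g \<in> schwartz" for g
      using schwartz_integrable[OF schwartz_shift[OF that, of "- y"]] by (intro pairing_integrand) simp
    have "0 = ?T (helmholtz_residual f) y"
      by (rule helmholtz_imp_translation_pairing_zero[OF H f, symmetric])
    also have "\<dots> = (LINT x|lborel. - (of_real (u x) * laplacian f (x - y)) - of_real (u x) * f (x - y))"
      by (simp add: translation_pairing_def algebra_simps)
    also have "\<dots> = - ?T (laplacian f) y - ?T f y"
      unfolding translation_pairing_def
      by (subst Bochner_Integration.integral_diff) (auto intro: int f schwartz_laplacian)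
    finally show ?thesis by (simp add: algebra_simps eq_neg_iff_add_eq_0)
  qed
  have Re: "((\<lambda>y. Re (F y)) has_real_derivative Re D) (at y)" if "(F has_vector_derivative D) (at y)" for F D y
    using bounded_linear.has_vector_derivative[OF bounded_linear_Re that]
    by (simp add: has_real_derivative_iff_has_vector_derivative)
  have d1: "((\<lambda>y. Re (?T f y)) has_real_derivative - Re (?T (partial_deriv 1 f) y)) (at y)" for y
    using Re[OF translation_pairing_derivative[OF u f, of y]] by simp
  have d2: "((\<lambda>y. - Re (?T (partial_deriv 1 f) y)) has_real_derivative - Re (?T f y)) (at y)" for y
    using DERIV_minus[OF Re[OF translation_pairing_derivative[OF u f1, of y]]] T[of y] by (simp add: lap)
  from harmonic_oscillator_solution[OF d1 d2] show ?thesis by blast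
qed

lemma interval_integral_cos_sin:
  fixes A B a b :: real
  assumes "a \<le> b"
  shows "integrable lborel (\<lambda>t. indicator {a..b} t * (A * cos t + B * sin t))"
    and "(LINT t|lborel. indicator {a..b} t * (A * cos t + B * sin t)) = A * (sin b - sin a) + B * (cos a - cos b)"
proof -
  have cont: "continuous_on {a..b} (\<lambda>t. A * cos t + B * sin t)" by (intro continuous_intros)
  show "integrable lborel (\<lambda>t. indicator {a..b} t * (A * cos t + B * sin t))"
    using borel_integrable_atLeastAtMost'[OF cont] by (simp add: set_integrable_def)
  have "(LINT t|lborel. indicator {a..b} t *\<^sub>R (A * cos t + B * sin t)) = (A * sin b - B * cos b) - (A * sin a - B * cos a)"
    by (rule integral_FTC_atLeastAtMost[OF assms _ cont])
       (auto intro!: derivative_eq_intros simp: has_real_derivative_iff_has_vector_derivative[symmetric])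
  then show "(LINT t|lborel. indicator {a..b} t * (A * cos t + B * sin t)) = A * (sin b - sin a) + B * (cos a - cos b)"
    by (simp add: algebra_simps)
qed

text \<open>If \<open>g\<close> has vanishing integral over every interval, then for small \<open>c > 0\<close> the measure with
  density \<open>1 + c g\<close> agrees with Lebesgue measure on intervals, hence everywhere.\<close>

lemma AE_zero_of_interval_integrals:
  fixes g :: "real \<Rightarrow> real"
  assumes g[measurable]: "g \<in> borel_measurable borel" and C: "\<And>x. \<bar>g x\<bar> \<le> C"
    and zero: "\<And>a b. a \<le> b \<Longrightarrow> (LINT t|lborel. indicator {a..b} t * g t) = 0"
  shows "AE x in lborel. g x = 0"
proof -
  define c where "c = 1 / (C + 1)"
  have C0: "C \<ge> 0" using C[of 0] by linarith
  have c: "c > 0" "\<bar>c * g x\<bar> \<le> 1" for x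
    using C0 C[of x] by (auto simp: c_def abs_mult divide_le_eq)
  have nonneg: "1 + c * g x \<ge> 0" for x using c(2)[of x] by linarith
  have int: "integrable lborel (\<lambda>t. indicator {a..b} t * h t)"
    if [measurable]: "h \<in> borel_measurable borel" and D: "\<And>t. \<bar>h t\<bar> \<le> D" for a b D and h :: "real \<Rightarrow> real"
  proof (rule Bochner_Integration.integrable_bound)
    show "integrable lborel (\<lambda>t. D * indicator {a..b} t)" by (cases "a \<le> b") (auto simp: integrable_indicator_iff)
    show "AE t in lborel. norm (indicator {a..b} t * h t) \<le> norm (D * indicator {a..b} t)"
      using D by (auto simp: indicator_def intro: order_trans[OF _ abs_ge_self])
  qed measurable
  have "lborel = density lborel (\<lambda>x. ennreal (1 + c * g x))"
  proof (rule lborel_eqI)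
    fix l r :: real assume "\<And>b. b \<in> Basis \<Longrightarrow> l \<bullet> b \<le> r \<bullet> b"
    then have lr: "l \<le> r" by simp
    have "emeasure (density lborel (\<lambda>x. ennreal (1 + c * g x))) (box l r) =
        (\<integral>\<^sup>+t. ennreal (indicator {l..r} t * (1 + c * g t)) \<partial>lborel)"
    proof (subst emeasure_density)
      show "(\<integral>\<^sup>+t. ennreal (1 + c * g t) * indicator (box l r) t \<partial>lborel) =
          (\<integral>\<^sup>+t. ennreal (indicator {l..r} t * (1 + c * g t)) \<partial>lborel)"
      proof (rule nn_integral_cong_AE)
        show "AE t in lborel. ennreal (1 + c * g t) * indicator (box l r) t = ennreal (indicator {l..r} t * (1 + c * g t))"
          using AE_lborel_singleton[of l] AE_lborel_singleton[of r]
          by eventually_elim (auto simp: indicator_def)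
      qed
    qed auto
    also have "\<dots> = ennreal (LINT t|lborel. indicator {l..r} t * (1 + c * g t))"
    proof (rule nn_integral_eq_integral)
      have "\<bar>1 + c * g t\<bar> \<le> 2" for t using c(2)[of t] by linarith
      then show "integrable lborel (\<lambda>t. indicator {l..r} t * (1 + c * g t))" by (intro int) auto
      show "AE t in lborel. 0 \<le> indicator {l..r} t * (1 + c * g t)" using nonneg by auto
    qed
    also have "(LINT t|lborel. indicator {l..r} t * (1 + c * g t)) =
        (LINT t|lborel. indicator {l..r} t * 1 + c * (indicator {l..r} t * g t))"
      by (intro Bochner_Integration.integral_cong) (auto simp: algebra_simps)
    also have "\<dots> = (LINT t|lborel. indicator {l..r} t * 1) + c * (LINT t|lborel. indicator {l..r} t * g t)"
      using int[of "\<lambda>_. 1" 1 l r] int[OF g C, of l r]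
      by (subst Bochner_Integration.integral_add) auto
    also have "\<dots> = r - l" using lr zero[OF lr] by simp
    finally show "emeasure (density lborel (\<lambda>x. ennreal (1 + c * g x))) (box l r) = (\<Prod>b\<in>Basis. (r - l) \<bullet> b)"
      by simp
  qed simp
  then have "density lborel (\<lambda>x. ennreal (1 + c * g x)) = density lborel (\<lambda>x. 1)"
    by (simp add: density_1)
  moreover have "sigma_finite_measure (density lborel (\<lambda>x::real. 1))"
    by (simp add: density_1 sigma_finite_lborel)
  ultimately have "AE x in lborel. ennreal (1 + c * g x) = 1"
    by (subst sigma_finite_density_unique[symmetric]) auto
  then show ?thesis
  proof eventually_elim
    fix x assume "ennreal (1 + c * g x) = 1"
    then have "1 + c * g x = 1" using nonneg[of x] by (metis ennreal_1 ennreal_inj zero_le_one)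
    then show "g x = 0" using c(1) by simp
  qed
qed

text \<open>Substitution of \<open>x = y + e z\<close>; it turns the Gaussian average of \<open>u\<close>, whose limit is studied below, into a
  pairing to which the equation applies.\<close>

lemma gaussian_translation_pairing:
  fixes u :: "real \<Rightarrow> real"
  assumes "bounded_borel u C" and e: "e > 0"
  shows "(LINT z|lborel. std_normal_density z * u (y + e * z)) =
    Re (translation_pairing u (\<lambda>x. complex_of_real (1 / (sqrt (2 * pi) * e)) * of_real (exp (- (1 / (2 * e\<^sup>2)) * x\<^sup>2))) y)"
proof -
  interpret bounded_borel u C by fact
  let ?F = "\<lambda>x. u x * (1 / (sqrt (2 * pi) * e) * exp (- (1 / (2 * e\<^sup>2)) * (x - y)\<^sup>2))"
  have "(LINT x|lborel. ?F x) = \<bar>e\<bar> *\<^sub>R (LINT z|lborel. ?F (y + e * z))"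
    using e by (intro lborel_integral_real_affine) auto
  also have "\<dots> = (LINT z|lborel. e * ?F (y + e * z))" using e by simp
  also have "\<dots> = (LINT z|lborel. std_normal_density z * u (y + e * z))"
    using e by (intro Bochner_Integration.integral_cong) (auto simp: std_normal_density_def power_mult_distrib)
  finally have "(LINT z|lborel. std_normal_density z * u (y + e * z)) = (LINT x|lborel. ?F x)" by simp
  also have "\<dots> = Re (LINT x|lborel. complex_of_real (?F x))"
    by (simp only: integral_complex_of_real Re_complex_of_real)
  finally show ?thesis by (simp only: translation_pairing_def of_real_mult)
qed

lemma
  fixes u :: "real \<Rightarrow> real"
  assumes "bounded_borel u C" and ab: "a \<le> b"
  shows integrable_indicator_bounded_borel: "integrable lborel (\<lambda>t. indicator {a..b} t * u (t + r))"
    and abs_interval_integral_le: "\<bar>LINT t|lborel. indicator {a..b} t * u (t + r)\<bar> \<le> C * (b - a)"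
proof -
  interpret bounded_borel u C by fact
  have int: "integrable lborel (\<lambda>t. C * indicator {a..b} t)" using ab by (auto simp: integrable_indicator_iff)
  have le: "norm (indicator {a..b} t * u (t + r)) \<le> C * indicator {a..b} t" for t
    using u_bounded[of "t + r"] by (auto simp: indicator_def)
  show *: "integrable lborel (\<lambda>t. indicator {a..b} t * u (t + r))"
    by (rule Bochner_Integration.integrable_bound[OF int])
       (use le C_nonneg in \<open>auto intro: order_trans[OF _ abs_ge_self]\<close>)
  have "\<bar>LINT t|lborel. indicator {a..b} t * u (t + r)\<bar> \<le> (LINT t|lborel. norm (indicator {a..b} t * u (t + r)))"
    using integral_norm_bound[of lborel "\<lambda>t. indicator {a..b} t * u (t + r)"] by simp
  also have "\<dots> \<le> (LINT t|lborel. C * indicator {a..b} t)"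
    by (rule integral_mono[OF integrable_norm[OF *] int le])
  also have "\<dots> = C * (b - a)" using ab by simp
  finally show "\<bar>LINT t|lborel. indicator {a..b} t * u (t + r)\<bar> \<le> C * (b - a)" .
qed

text \<open>Translation is continuous on integrals over an interval: the shift is moved to the
  indicator function, which converges off the two end points.\<close>

lemma interval_integral_shift_tendsto:
  fixes u :: "real \<Rightarrow> real"
  assumes "bounded_borel u C" and ab: "a \<le> b" and X: "X \<longlonglongrightarrow> 0"
  shows "(\<lambda>n. LINT t|lborel. indicator {a..b} t * u (t + X n)) \<longlonglongrightarrow> (LINT t|lborel. indicator {a..b} t * u t)"
proof -
  interpret bounded_borel u C by fact
  obtain R where R: "\<And>n. \<bar>X n\<bar> \<le> R"
    using convergent_imp_Bseq[of X] X by (auto simp: convergent_def Bseq_def)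
  have eq: "(LINT t|lborel. indicator {a..b} t * u (t + r)) = (LINT t|lborel. indicator {a..b} (t - r) * u t)" for r
    using lborel_integral_real_affine[of 1 "\<lambda>t. indicator {a..b} (t - r) * u t" r] by (simp add: add.commute)
  show ?thesis unfolding eq
  proof (rule integral_dominated_convergence)
    show "integrable lborel (\<lambda>t. C * indicator {a - R..b + R} t)"
      by (cases "a - R \<le> b + R") (auto simp: integrable_indicator_iff)
    show "AE t in lborel. (\<lambda>n. indicator {a..b} (t - X n) * u t) \<longlonglongrightarrow> indicator {a..b} t * u t"
      using AE_lborel_singleton[of a] AE_lborel_singleton[of b]
    proof eventually_elim
      fix t assume t: "t \<noteq> a" "t \<noteq> b"
      have lim: "(\<lambda>n. t - X n) \<longlonglongrightarrow> t" using tendsto_diff[OF tendsto_const X, of t] by simp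
      consider "t < a" | "a < t" "t < b" | "b < t" using t by linarith
      then have "\<forall>\<^sub>F n in sequentially. (indicator {a..b} (t - X n) :: real) = indicator {a..b} t"
      proof cases
        case 1
        from order_tendstoD(2)[OF lim 1] show ?thesis by eventually_elim (use 1 in \<open>auto simp: indicator_def\<close>)
      next
        case 2
        from order_tendstoD(1)[OF lim 2(1)] order_tendstoD(2)[OF lim 2(2)] show ?thesis
          by eventually_elim (use 2 in \<open>auto simp: indicator_def\<close>)
      next
        case 3
        from order_tendstoD(1)[OF lim 3] show ?thesis by eventually_elim (use 3 in \<open>auto simp: indicator_def\<close>)
      qed
      then have "\<forall>\<^sub>F n in sequentially. indicator {a..b} (t - X n) * u t = indicator {a..b} t * u t"
        by eventually_elim simp
      then show "(\<lambda>n. indicator {a..b} (t - X n) * u t) \<longlonglongrightarrow> indicator {a..b} t * u t"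
        by (rule tendsto_eventually)
    qed
    show "AE t in lborel. norm (indicator {a..b} (t - X n) * u t) \<le> C * indicator {a - R..b + R} t" for n
      using u_bounded R[of n] C_nonneg by (intro AE_I2) (auto simp: indicator_def abs_le_iff)
  qed auto
qed

text \<open>The mollified integral is a Gaussian average of the shifted integrals of
  \<open>interval_integral_shift_tendsto\<close>, which are bounded uniformly in the shift.\<close>

lemma mollified_interval_integral_tendsto:
  fixes u :: "real \<Rightarrow> real"
  assumes u: "bounded_borel u C" and ab: "a \<le> b" and X: "X \<longlonglongrightarrow> 0"
  shows "(\<lambda>n. LINT t|lborel. indicator {a..b} t * (LINT z|lborel. std_normal_density z * u (t + X n * z)))
    \<longlonglongrightarrow> (LINT t|lborel. indicator {a..b} t * u t)"
proof -
  interpret bounded_borel u C by fact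
  have Fubini: "(LINT t|lborel. indicator {a..b} t * (LINT z|lborel. std_normal_density z * u (t + e * z))) =
      (LINT z|lborel. std_normal_density z * (LINT t|lborel. indicator {a..b} t * u (t + e * z)))" for e
  proof -
    have "integrable (lborel \<Otimes>\<^sub>M lborel) (\<lambda>(t::real, z). indicator {a..b} t * std_normal_density z * u (t + e * z))"
    proof (rule Bochner_Integration.integrable_bound)
      show "integrable (lborel \<Otimes>\<^sub>M lborel) (\<lambda>(t::real, z). C * (indicator {a..b} t * std_normal_density z))"
      proof (rule lborel_pair.Fubini_integrable)
        show "AE t in lborel. integrable lborel (\<lambda>z. (\<lambda>(t, z). C * (indicator {a..b} t * std_normal_density z)) (t, z))"
          by (simp add: integrable_normal_density)
        have "(LINT z|lborel. norm ((\<lambda>(t, z). C * (indicator {a..b} t * std_normal_density z)) (t, z))) =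
            C * indicator {a..b} t" for t :: real
          using C_nonneg by (simp add: abs_mult normal_density_nonneg integral_normal_density)
        then show "integrable lborel (\<lambda>t. LINT z|lborel. norm ((\<lambda>(t, z). C * (indicator {a..b} t * std_normal_density z)) (t, z)))"
          using ab by (simp add: integrable_indicator_iff)
      qed auto
      show "AE p in lborel \<Otimes>\<^sub>M lborel. norm ((\<lambda>(t, z). indicator {a..b} t * std_normal_density z * u (t + e * z)) p)
          \<le> norm ((\<lambda>(t, z). C * (indicator {a..b} t * std_normal_density z)) p)"
        using u_bounded C_nonneg
        by (intro AE_I2) (auto simp: abs_mult normal_density_nonneg indicator_def mult.commute[of C] intro!: mult_left_mono)
    qed auto
    from lborel_pair.Fubini_integral[OF this]
    have "(LINT z|lborel. LINT t|lborel. indicator {a..b} t * std_normal_density z * u (t + e * z)) =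
        (LINT t|lborel. LINT z|lborel. indicator {a..b} t * std_normal_density z * u (t + e * z))" by simp
    moreover have "(LINT t|lborel. indicator {a..b} t * std_normal_density z * u (t + e * z)) =
        std_normal_density z * (LINT t|lborel. indicator {a..b} t * u (t + e * z))" for z
      by (subst integral_mult_right_zero[symmetric]) (simp add: mult_ac)
    moreover have "(LINT z|lborel. indicator {a..b} t * std_normal_density z * u (t + e * z)) =
        indicator {a..b} t * (LINT z|lborel. std_normal_density z * u (t + e * z))" for t
      by (subst integral_mult_right_zero[symmetric]) (simp add: mult_ac)
    ultimately show ?thesis by simp
  qed
  have "(\<lambda>n. LINT z|lborel. std_normal_density z * (LINT t|lborel. indicator {a..b} t * u (t + X n * z)))
      \<longlonglongrightarrow> (LINT z|lborel. std_normal_density z * (LINT t|lborel. indicator {a..b} t * u t))"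
  proof (rule integral_dominated_convergence)
    show "integrable lborel (\<lambda>z. std_normal_density z * (C * (b - a)))" by simp
    show "AE z in lborel. (\<lambda>n. std_normal_density z * (LINT t|lborel. indicator {a..b} t * u (t + X n * z)))
        \<longlonglongrightarrow> std_normal_density z * (LINT t|lborel. indicator {a..b} t * u t)"
    proof (intro AE_I2 tendsto_mult tendsto_const interval_integral_shift_tendsto[OF u ab])
      fix z
      show "(\<lambda>n. X n * z) \<longlonglongrightarrow> 0" using tendsto_mult[OF X tendsto_const, of z] by simp
    qed
    show "AE z in lborel. norm (std_normal_density z * (LINT t|lborel. indicator {a..b} t * u (t + X n * z)))
        \<le> std_normal_density z * (C * (b - a))" for n
      using abs_interval_integral_le[OF u ab]
      by (intro AE_I2) (auto simp: abs_mult normal_density_nonneg intro!: mult_left_mono)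
  qed auto
  then show ?thesis unfolding Fubini by (simp add: integral_normal_density)
qed

text \<open>The mollifications are \<open>A\<^sub>n cos + B\<^sub>n sin\<close>. Their integrals converge to those of \<open>u\<close> over every interval;
  the intervals \<open>[0, \<pi>]\<close> and \<open>[0, \<pi>/2]\<close> give \<open>2 B\<^sub>n\<close> and \<open>A\<^sub>n + B\<^sub>n\<close>, so the coefficients converge. In the
  limit, \<open>u\<close> and \<open>A cos + B sin\<close> have the same integral over every interval.\<close>

theorem helmholtz_1D:
  fixes u :: "real \<Rightarrow> real"
  assumes u: "bounded_borel u C" and H: "helmholtz u"
  shows "\<exists>A B. AE x in lborel. u x = A * cos x + B * sin x"
proof -
  interpret bounded_borel u C by fact
  define X where "X n = 1 / real (Suc n)" for n
  have X: "X \<longlonglongrightarrow> 0" "\<And>n. X n > 0" unfolding X_def by (rule LIMSEQ_Suc[OF lim_1_over_n]) simp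
  have "\<exists>A B. \<forall>y. (LINT z|lborel. std_normal_density z * u (y + X n * z)) = A * cos y + B * sin y" for n
    unfolding gaussian_translation_pairing[OF u X(2)]
    by (intro helmholtz_translation_pairing_1D[OF u H] schwartz_cmult gaussian_schwartz) (use X(2)[of n] in simp)
  then obtain A B where AB: "\<And>n y. (LINT z|lborel. std_normal_density z * u (y + X n * z)) = A n * cos y + B n * sin y"
    by metis
  let ?I = "\<lambda>a b. LINT t|lborel. indicator {a..b} t * u t"
  have lim: "(\<lambda>n. A n * (sin b - sin a) + B n * (cos a - cos b)) \<longlonglongrightarrow> ?I a b" if "a \<le> b" for a b
    using mollified_interval_integral_tendsto[OF u that X(1)]
    unfolding AB interval_integral_cos_sin(2)[OF that] .
  have "(\<lambda>n. (A n * (sin pi - sin 0) + B n * (cos 0 - cos pi)) / 2) \<longlonglongrightarrow> ?I 0 pi / 2"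
    by (intro tendsto_intros lim) auto
  then have B: "B \<longlonglongrightarrow> ?I 0 pi / 2" by simp
  have "(\<lambda>n. (A n * (sin (pi / 2) - sin 0) + B n * (cos 0 - cos (pi / 2))) - B n) \<longlonglongrightarrow> ?I 0 (pi / 2) - ?I 0 pi / 2"
    by (intro tendsto_diff lim B) auto
  then have A: "A \<longlonglongrightarrow> ?I 0 (pi / 2) - ?I 0 pi / 2" by simp
  define a0 where "a0 = ?I 0 (pi / 2) - ?I 0 pi / 2"
  define b0 where "b0 = ?I 0 pi / 2"
  have I: "?I a b = a0 * (sin b - sin a) + b0 * (cos a - cos b)" if "a \<le> b" for a b
  proof (rule LIMSEQ_unique[OF lim[OF that]])
    show "(\<lambda>n. A n * (sin b - sin a) + B n * (cos a - cos b)) \<longlonglongrightarrow> a0 * (sin b - sin a) + b0 * (cos a - cos b)"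
      unfolding a0_def b0_def by (intro tendsto_intros A B)
  qed
  have "AE x in lborel. u x - (a0 * cos x + b0 * sin x) = 0"
  proof (rule AE_zero_of_interval_integrals)
    show "\<bar>u x - (a0 * cos x + b0 * sin x)\<bar> \<le> C + \<bar>a0\<bar> + \<bar>b0\<bar>" for x
    proof -
      have "\<bar>a0 * cos x\<bar> \<le> \<bar>a0\<bar>" "\<bar>b0 * sin x\<bar> \<le> \<bar>b0\<bar>"
        by (auto simp: abs_mult intro!: mult_left_le)
      then show ?thesis using u_bounded[of x] by linarith
    qed
    fix a b :: real assume ab: "a \<le> b"
    have "integrable lborel (\<lambda>t. indicator {a..b} t * u t)"
      using integrable_indicator_bounded_borel[OF u ab, of 0] by simp
    from Bochner_Integration.integral_diff[OF this interval_integral_cos_sin(1)[OF ab, of a0 b0]]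
    have "(LINT t|lborel. indicator {a..b} t * u t - indicator {a..b} t * (a0 * cos t + b0 * sin t)) = 0"
      unfolding interval_integral_cos_sin(2)[OF ab] I[OF ab] by simp
    then show "(LINT t|lborel. indicator {a..b} t * (u t - (a0 * cos t + b0 * sin t))) = 0"
      by (simp only: right_diff_distrib)
  qed measurable
  then show ?thesis by auto
qed

section \<open>Reduction to bounded Borel functions\<close>

lemma pairing_cong_AE:
  assumes "u \<in> borel_measurable lebesgue" "v \<in> borel_measurable lebesgue"
    and "AE x in lebesgue. u x = v x" and "f \<in> borel_measurable borel"
  shows "pairing u f = pairing v f"
  unfolding pairing_def
proof (rule integral_cong_AE)
  have [measurable]: "f \<in> borel_measurable lebesgue" using assms(4) by (simp add: measurable_completion)
  note [measurable] = assms(1,2)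
  show "(\<lambda>x. complex_of_real (u x) * f x) \<in> borel_measurable lebesgue"
    "(\<lambda>x. complex_of_real (v x) * f x) \<in> borel_measurable lebesgue" by measurable
  show "AE x in lebesgue. complex_of_real (u x) * f x = complex_of_real (v x) * f x"
    using assms(3) by eventually_elim simp
qed

text \<open>A Borel representative, truncated at the essential bound.\<close>

lemma L_infty_bounded_borel:
  assumes "u \<in> L_infty"
  shows "\<exists>v C. bounded_borel v C \<and> (AE x in lebesgue. u x = v x)"
proof -
  from assms obtain C where u[measurable]: "u \<in> borel_measurable lebesgue" and C: "AE x in lebesgue. \<bar>u x\<bar> \<le> C"
    unfolding L_infty_def by auto
  obtain v where v[measurable]: "v \<in> borel_measurable lborel" and uv: "AE x in lborel. u x = v x"
    using completion_ex_borel_measurable_real[OF u] by auto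
  define w where "w x = max (- \<bar>C\<bar>) (min \<bar>C\<bar> (v x))" for x
  have "bounded_borel w \<bar>C\<bar>"
    by unfold_locales (auto simp: w_def[abs_def])
  moreover have "AE x in lebesgue. u x = w x"
    using C AE_completion[OF uv] by eventually_elim (auto simp: w_def)
  ultimately show ?thesis by blast
qed

lemma frac_laplacian_measurable:
  fixes f :: "'a::euclidean_space \<Rightarrow> complex"
  assumes "f \<in> schwartz" "0 < s" "s < 1"
  shows "frac_laplacian s f \<in> borel_measurable borel"
proof -
  interpret bounded_borel "\<lambda>_::'a. 0" 0 by unfold_locales auto
  show ?thesis using frac_laplacian_integrable[OF assms] by auto
qed

lemma
  fixes u v :: "'a::euclidean_space \<Rightarrow> real"
  assumes uv: "u \<in> borel_measurable lebesgue" "v \<in> borel_measurable lebesgue" "AE x in lebesgue. u x = v x"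
  shows helmholtz_cong_AE: "helmholtz u \<longleftrightarrow> helmholtz v"
    and frac_helmholtz_cong_AE: "0 < s \<Longrightarrow> s < 1 \<Longrightarrow> frac_helmholtz s u \<longleftrightarrow> frac_helmholtz s v"
proof -
  note eq = pairing_cong_AE[OF uv]
  show "helmholtz u \<longleftrightarrow> helmholtz v"
    unfolding helmholtz_def distributional_laplacian_def
    by (auto simp: eq schwartz_measurable schwartz_laplacian)
  show "frac_helmholtz s u \<longleftrightarrow> frac_helmholtz s v" if "0 < s" "s < 1"
    unfolding frac_helmholtz_def distributional_frac_laplacian_def
    using that by (auto simp: eq schwartz_measurable frac_laplacian_measurable)
qed

theorem frac_helmholtz_iff_helmholtz:
  fixes u :: "'a::euclidean_space \<Rightarrow> real"
  assumes u: "u \<in> L_infty" and s: "0 < s" "s < 1"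
  shows "frac_helmholtz s u \<longleftrightarrow> helmholtz u"
proof -
  obtain v C where v: "bounded_borel v C" and uv: "AE x in lebesgue. u x = v x"
    using L_infty_bounded_borel[OF u] by metis
  interpret bounded_borel v C by fact
  have m: "u \<in> borel_measurable lebesgue" "v \<in> borel_measurable lebesgue"
    using u by (auto simp: L_infty_def measurable_completion)
  show ?thesis
    unfolding helmholtz_cong_AE[OF m uv] frac_helmholtz_cong_AE[OF m uv s]
    using helmholtz_imp_frac_helmholtz[OF s] frac_helmholtz_imp_helmholtz[OF s] by blast
qed

theorem theorem1p1:
  fixes s :: real
  assumes "0 < s" and "s < 1"
  shows "(\<forall>u::real \<Rightarrow> real. u \<in> L_infty \<longrightarrow> frac_helmholtz s u \<longrightarrow>
            (\<exists>A B::real. AE x in lebesgue. u x = A * cos x + B * sin x))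
       \<and> (\<forall>u::real ^ 'n \<Rightarrow> real. CARD('n) \<ge> 2 \<longrightarrow> u \<in> L_infty \<longrightarrow> vanishes_at_infinity u \<longrightarrow>
            (frac_helmholtz s u \<longleftrightarrow> helmholtz u))"
proof (intro conjI allI impI)
  fix u :: "real \<Rightarrow> real" assume u: "u \<in> L_infty" and F: "frac_helmholtz s u"
  obtain v C where v: "bounded_borel v C" and uv: "AE x in lebesgue. u x = v x"
    using L_infty_bounded_borel[OF u] by metis
  interpret bounded_borel v C by fact
  have m: "u \<in> borel_measurable lebesgue" "v \<in> borel_measurable lebesgue"
    using u by (auto simp: L_infty_def measurable_completion)
  have "helmholtz v"
    using F frac_helmholtz_iff_helmholtz[OF u assms] helmholtz_cong_AE[OF m uv] by simp
  then obtain A B where "AE x in lborel. v x = A * cos x + B * sin x"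
    using helmholtz_1D[OF v] by blast
  from AE_completion[OF this] uv have "AE x in lebesgue. u x = A * cos x + B * sin x"
    by eventually_elim simp
  then show "\<exists>A B. AE x in lebesgue. u x = A * cos x + B * sin x" by blast
next
  fix u :: "real ^ 'n \<Rightarrow> real" assume "u \<in> L_infty"
  then show "frac_helmholtz s u \<longleftrightarrow> helmholtz u" using assms by (rule frac_helmholtz_iff_helmholtz)
qed

end
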